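(* Let $\mu_0$ be a translation invariant probability measure on $X=\{0,1\}^{\mathbb Z}$ and for integers $t\ge0$ let $\mu_t=U^t_*\mu_0$ be its image under $t$ steps of the F-TASEP dynamics. Then $\mu_\infty=\lim_{t\to\infty}\mu_t$ exists (in the sense of weak convergence of probability measures on $X$ with the product topology).
   Context: F-TASEP step $U:X\to X$, $X=\{0,1\}^{\mathbb Z}$ ($1$ = particle, $0$ = hole): simultaneously, every particle at a site $j$ with $\eta(j-1)=1$ and $\eta(j+1)=0$ moves to $j+1$. For a measure $\lambda$ on $X$, $U_*\lambda=\lambda\circ U^{-1}$. *)

theory Defs
  imports "HOL-Probability.Probability"
begin

text \<open>
  A configuration is a function on the integers, with \<^term>\<open>True\<close> for a particle and
  \<^term>\<open>False\<close> for a hole. The type \<open>int \<Rightarrow> bool\<close> carries the product topology of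
  \<^theory>\<open>HOL-Analysis.Function_Topology\<close> (with \<^typ>\<open>bool\<close> discrete), and \<^term>\<open>borel\<close> is its
  Borel sigma-algebra.
\<close>
type_synonym config = "int \<Rightarrow> bool"

definition jumps :: "config \<Rightarrow> int \<Rightarrow> bool" where
  "jumps \<eta> j \<longleftrightarrow> \<eta> j \<and> \<eta> (j - 1) \<and> \<not> \<eta> (j + 1)"

text \<open>
  After a parallel update, a site is occupied iff its particle stayed or the particle to its
  left jumped in.
\<close>
definition ftasep_step :: "config \<Rightarrow> config" where
  "ftasep_step \<eta> = (\<lambda>j. (\<eta> j \<and> \<not> jumps \<eta> j) \<or> jumps \<eta> (j - 1))"

definition translate :: "int \<Rightarrow> config \<Rightarrow> config" where
  "translate k \<eta> = (\<lambda>j. \<eta> (j - k))"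

definition config_measure :: "config measure \<Rightarrow> bool" where
  "config_measure \<mu> \<longleftrightarrow> prob_space \<mu> \<and> sets \<mu> = sets borel"

text \<open>Being defined through \<^const>\<open>distr\<close>, this and \<open>ftasep_evolve\<close> below use that the maps
  involved are Borel measurable; this is proved at the end.\<close>
definition translation_invariant :: "config measure \<Rightarrow> bool" where
  "translation_invariant \<mu> \<longleftrightarrow> (\<forall>k. distr \<mu> borel (translate k) = \<mu>)"

definition ftasep_evolve :: "config measure \<Rightarrow> nat \<Rightarrow> config measure" where
  "ftasep_evolve \<mu> t = distr \<mu> borel (ftasep_step ^^ t)"

text \<open>The library's \<^const>\<open>weak_conv_m\<close> only covers measures on the real line.\<close>
definition converges_weakly ::
  "(nat \<Rightarrow> 'a::topological_space measure) \<Rightarrow> 'a measure \<Rightarrow> bool" where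
  "converges_weakly M N \<longleftrightarrow>
     (\<forall>f :: 'a \<Rightarrow> real. continuous_on UNIV f \<and> bounded (range f) \<longrightarrow>
        (\<lambda>n. \<integral>x. f x \<partial>M n) \<longlonglongrightarrow> (\<integral>x. f x \<partial>N))"

instance bool :: second_countable_topology
proof
  show "\<exists>B :: bool set set. countable B \<and> open = generate_topology B"
    by (rule exI[of _ "range lessThan \<union> range greaterThan"]) (auto simp: open_bool_def)
qed

lemma measurable_eval [measurable]: "(\<lambda>\<eta> :: config. \<eta> i) \<in> borel \<rightarrow>\<^sub>M count_space UNIV"
proof -
  have "(\<lambda>\<eta> :: config. \<eta> i) \<in> borel \<rightarrow>\<^sub>M borel"
    by (rule borel_measurable_continuous_onI) simp
  then show ?thesis
    by (simp add: measurable_cong_sets[OF refl sets_borel_eq_count_space])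
qed

lemma measurable_config:
  assumes "\<And>i. (\<lambda>x. g x i) \<in> M \<rightarrow>\<^sub>M count_space UNIV"
  shows "g \<in> M \<rightarrow>\<^sub>M (borel :: config measure)"
  by (rule measurable_coordinatewise_then_product)
    (simp add: assms measurable_cong_sets[OF refl sets_borel_eq_count_space])

lemma measurable_translate [measurable]: "translate k \<in> borel \<rightarrow>\<^sub>M borel"
  unfolding translate_def by (rule measurable_config) measurable

lemma measurable_ftasep_step [measurable]: "ftasep_step \<in> borel \<rightarrow>\<^sub>M borel"
  unfolding ftasep_step_def jumps_def by (rule measurable_config) measurable

lemma measurable_ftasep_steps [measurable]: "ftasep_step ^^ t \<in> borel \<rightarrow>\<^sub>M borel"
  by (rule measurable_compose_n) (rule measurable_ftasep_step)

end

(* Three cases are separated by the trajectory of the configuration. If some site stays empty forever,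
   then by stationarity such sites lie arbitrarily far to the left, and since no particle crosses
   them the configuration freezes to their right. If some site of the frame moving left at unit speed
   stays occupied forever, the configuration converges pointwise in that frame, for a dual reason.
   Otherwise hole pairs 00, which are static, and triples 111, which are static in the moving frame,
   die out in density. Record, for every hole, whether its two left neighbours are occupied. A step
   moves this word from each hole to the next one and changes a letter only by destroying a 00 or a
   111, so mass transport bounds the change of the law of the word by the loss of density of these
   patterns, which telescopes. Once 00 and 111 are rare, the word determines the configuration. *)

theory Submission
  imports Defs
begin

section \<open>Weak limits of configuration measures\<close>

text \<open>The letter is chosen for a gap identity. Without 00 and 111 consecutive holes are 2 or 3
  apart, and a letter b (read as 0 or 1) says that its hole lies 2 + b to the right of the previous
  one. A hole moves left exactly if its letter is set, so for consecutive holes with letters b and c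
  the gap becomes (2 + c) - c + b = 2 + b: the right hole inherits the letter of the left one. Since
  letters are handed on forever, sites need not settle, and only laws are tracked. Rarity of 00 and
  111 would not by itself control these laws, because the errors of infinitely many steps could add
  up. What is summed is the density destroyed in each step, in total at most the initial density. A
  word starts at a hole, and the hole at a given site changes with time; mass transport lets an
  event at a receiving hole be counted at the sending one, so all laws can be compared at the
  origin. Each of the three cases is a translation invariant event to which the measure can be
  restricted; this is the reason for working with finite measures.\<close>

definition depends_on :: "int set \<Rightarrow> config set \<Rightarrow> bool" where
  "depends_on S C \<longleftrightarrow> (\<forall>\<eta> \<zeta>. (\<forall>i\<in>S. \<eta> i = \<zeta> i) \<longrightarrow> (\<eta> \<in> C \<longleftrightarrow> \<zeta> \<in> C))"

text \<open>The cylinder events: clopen in the product topology, and an algebra that generates the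
  Borel sets.\<close>

definition local_sets :: "config set set" where
  "local_sets = {C. \<exists>S. finite S \<and> depends_on S C}"

lemma depends_on_mono: "depends_on S C \<Longrightarrow> S \<subseteq> T \<Longrightarrow> depends_on T C"
  unfolding depends_on_def by blast

lemma algebra_local_sets: "algebra UNIV local_sets"
  unfolding algebra_iff_Un local_sets_def
proof (intro conjI ballI)
  show "{} \<in> {C. \<exists>S. finite S \<and> depends_on S C}"
    by (auto simp: depends_on_def)
next
  fix A assume "A \<in> {C. \<exists>S. finite S \<and> depends_on S C}"
  then show "UNIV - A \<in> {C. \<exists>S. finite S \<and> depends_on S C}"
    by (auto simp: depends_on_def)
next
  fix A B assume "A \<in> {C. \<exists>S. finite S \<and> depends_on S C}" "B \<in> {C. \<exists>S. finite S \<and> depends_on S C}"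
  then obtain S T where "finite S" "finite T" "depends_on S A" "depends_on T B" by auto
  then have "finite (S \<union> T)" "depends_on (S \<union> T) (A \<union> B)"
    unfolding depends_on_def by blast+
  then show "A \<union> B \<in> {C. \<exists>S. finite S \<and> depends_on S C}" by blast
qed auto


section \<open>Compactness of the configuration space\<close>

lemma compact_config: "compact (UNIV :: config set)"
proof -
  have "compact_space (product_topology (\<lambda>i::int. euclidean :: bool topology) UNIV)"
  proof -
    have "compact_space (euclidean :: bool topology)"
      by (simp add: compact_space_def finite_imp_compact)
    then show ?thesis unfolding compact_space_product_topology by blast
  qed
  then show ?thesis
    by (metis compactin_euclidean_iff compact_space_def euclidean_product_topology topspace_euclidean)
qed

lemma local_nbhd:
  fixes U :: "config set"
  assumes "open U" "\<zeta> \<in> U"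
  obtains S where "finite S" "\<And>\<eta>. \<forall>i\<in>S. \<eta> i = \<zeta> i \<Longrightarrow> \<eta> \<in> U"
proof -
  have "openin (product_topology (\<lambda>i. euclidean) UNIV) U"
    using assms by (simp add: euclidean_product_topology)
  from product_topology_open_contains_basis[OF this assms(2)]
  obtain X where X: "\<zeta> \<in> (\<Pi>\<^sub>E i\<in>UNIV. X i)" "finite {i. X i \<noteq> UNIV}" "(\<Pi>\<^sub>E i\<in>UNIV. X i) \<subseteq> U"
    by auto
  show ?thesis
  proof (rule that[OF X(2)])
    fix \<eta> assume "\<forall>i\<in>{i. X i \<noteq> UNIV}. \<eta> i = \<zeta> i"
    then have "\<eta> i \<in> X i" for i using X(1) by (cases "X i = UNIV") (auto simp: PiE_iff)
    then have "\<eta> \<in> (\<Pi>\<^sub>E i\<in>UNIV. X i)" by (simp add: PiE_iff)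
    then show "\<eta> \<in> U" using X by auto
  qed
qed

lemma open_bool_singleton: "open {b :: bool}"
proof -
  have "{True} = {False<..}" "{False} = {..<True}" by auto
  then show ?thesis by (cases b) (metis open_greaterThan, metis open_lessThan)
qed

lemma local_open:
  assumes "C \<in> local_sets" shows "open C"
proof -
  obtain S where S: "finite S" "depends_on S C" using assms by (auto simp: local_sets_def)
  have "C = (\<Union>\<zeta>\<in>C. \<Inter>i\<in>S. (\<lambda>\<eta>. \<eta> i) -` {\<zeta> i})"
    using S(2) unfolding depends_on_def by auto
  moreover have "open ((\<lambda>\<eta> :: config. \<eta> i) -` {b})" for i b
    by (intro open_vimage continuous_on_product_coordinates open_bool_singleton)
  ultimately show ?thesis
    using S(1) by (metis (no_types, lifting) open_INT open_UN)
qed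

lemma local_borel: "C \<in> local_sets \<Longrightarrow> C \<in> sets borel"
  by (simp add: local_open)

lemma local_compl: "C \<in> local_sets \<Longrightarrow> - C \<in> local_sets"
  using algebra_local_sets by (simp add: algebra_iff_Un Compl_eq_Diff_UNIV)

text \<open>Uniform continuity on a compact space, with agreement on finitely many sites in place of
  a distance: finitely many cylinders on which \<open>f\<close> stays within \<open>e / 2\<close> of
  its value at the centre cover everything, and \<open>S\<close> collects their sites.\<close>

lemma uniformly_local:
  fixes f :: "config \<Rightarrow> real"
  assumes "continuous_on UNIV f" "e > 0"
  obtains S where "finite S" "\<And>\<eta> \<zeta>. \<forall>i\<in>S. \<eta> i = \<zeta> i \<Longrightarrow> \<bar>f \<eta> - f \<zeta>\<bar> < e"
proof -
  have "\<exists>S. finite S \<and> (\<forall>\<eta>. (\<forall>i\<in>S. \<eta> i = \<zeta> i) \<longrightarrow> \<bar>f \<eta> - f \<zeta>\<bar> < e / 2)" for \<zeta>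
  proof -
    have "open (f -` ball (f \<zeta>) (e / 2))" using assms(1) by (intro open_vimage) auto
    moreover have "\<zeta> \<in> f -` ball (f \<zeta>) (e / 2)" using assms(2) by simp
    ultimately obtain S where "finite S" "\<And>\<eta>. \<forall>i\<in>S. \<eta> i = \<zeta> i \<Longrightarrow> \<eta> \<in> f -` ball (f \<zeta>) (e / 2)"
      by (rule local_nbhd) blast
    then show ?thesis by (auto simp: dist_real_def abs_minus_commute intro!: exI[of _ S])
  qed
  then obtain S where S: "\<And>\<zeta>. finite (S \<zeta>)"
    "\<And>\<zeta> \<eta>. \<forall>i\<in>S \<zeta>. \<eta> i = \<zeta> i \<Longrightarrow> \<bar>f \<eta> - f \<zeta>\<bar> < e / 2" by metis
  define V where "V \<zeta> = {\<eta>. \<forall>i\<in>S \<zeta>. \<eta> i = \<zeta> i}" for \<zeta>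
  have "open (V \<zeta>)" for \<zeta>
    by (intro local_open) (auto simp: V_def local_sets_def depends_on_def intro!: exI[of _ "S \<zeta>"] S(1))
  then obtain F where F: "finite F" "UNIV \<subseteq> (\<Union>\<zeta>\<in>F. V \<zeta>)"
    using compactE_image[OF compact_config, of UNIV V] by (auto simp: V_def)
  show ?thesis
  proof (rule that)
    show "finite (\<Union>\<zeta>\<in>F. S \<zeta>)" using F S by auto
    fix \<eta> \<zeta> :: config assume *: "\<forall>i\<in>(\<Union>\<zeta>\<in>F. S \<zeta>). \<eta> i = \<zeta> i"
    obtain \<xi> where \<xi>: "\<xi> \<in> F" "\<zeta> \<in> V \<xi>" using F by auto
    then have "\<bar>f \<zeta> - f \<xi>\<bar> < e / 2" by (intro S(2)) (auto simp: V_def)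
    moreover have "\<bar>f \<eta> - f \<xi>\<bar> < e / 2" using * \<xi> by (intro S(2)) (auto simp: V_def)
    ultimately show "\<bar>f \<eta> - f \<zeta>\<bar> < e" by linarith
  qed
qed

lemma sigma_sets_local: "sigma_sets UNIV local_sets = sets (borel :: config measure)"
proof
  show "sigma_sets UNIV local_sets \<subseteq> sets (borel :: config measure)"
    using sets.sigma_sets_subset[of local_sets borel] local_borel by auto
  have "(\<lambda>x. x) \<in> sigma UNIV local_sets \<rightarrow>\<^sub>M (borel :: config measure)"
  proof (rule measurable_config)
    fix i :: int
    have "{\<eta> :: config. \<eta> i \<in> B} \<in> local_sets" for B
      by (auto simp: local_sets_def depends_on_def intro!: exI[of _ "{i}"])
    then show "(\<lambda>\<eta>. \<eta> i) \<in> sigma UNIV local_sets \<rightarrow>\<^sub>M count_space UNIV"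
      by (auto simp: measurable_def vimage_def)
  qed
  from measurable_sets[OF this] show "sets (borel :: config measure) \<subseteq> sigma_sets UNIV local_sets"
    by auto
qed

text \<open>The complements are open and cover a compact space, so finitely many of them do. This is
  the source of countable additivity for the limit measure.\<close>

lemma decseq_local_empty:
  assumes "range A \<subseteq> local_sets" "decseq A" "(\<Inter>i. A i) = {}"
  shows "\<exists>n :: nat. A n = {}"
proof (rule ccontr)
  assume ne: "\<nexists>n. A n = {}"
  have "UNIV \<subseteq> (\<Union>i. - A i)" using assms(3) by auto
  moreover have "open (- A i)" for i
    using assms(1) by (intro local_open local_compl) auto
  ultimately obtain F where F: "finite F" "UNIV \<subseteq> (\<Union>i\<in>F. - A i)"
    using compactE_image[OF compact_config, of UNIV "\<lambda>i. - A i"] by auto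
  have "F \<noteq> {}" using F by auto
  have "A (Max F) \<subseteq> A i" if "i \<in> F" for i using assms(2) that F by (simp add: decseqD)
  then have "A (Max F) = {}" using F(2) by blast
  then show False using ne by blast
qed

text \<open>The limits on local sets are finitely additive, and Caratheodory extends them:
  continuity at the empty set holds because a decreasing sequence of local sets with empty
  intersection is eventually empty. Continuous functions are then handled by uniform approximation
  with local ones.\<close>

theorem weak_limit_exists:
  fixes M :: "nat \<Rightarrow> config measure"
  assumes M: "\<And>t. config_measure (M t)"
    and conv: "\<And>C. C \<in> local_sets \<Longrightarrow> convergent (\<lambda>t. measure (M t) C)"
  shows "\<exists>N. config_measure N \<and> converges_weakly M N"
proof -
  have pM: "prob_space (M t)" and sM [measurable_cong]: "sets (M t) = sets borel" for t
    using M by (auto simp: config_measure_def)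
  have fM: "finite_measure (M t)" for t
    using pM by (simp add: prob_space_def)
  have spM: "space (M t) = UNIV" for t
    using sets_eq_imp_space_eq[OF sM] by simp
  define p where "p C = lim (\<lambda>t. measure (M t) C)" for C
  have p: "(\<lambda>t. measure (M t) C) \<longlonglongrightarrow> p C" if "C \<in> local_sets" for C
    using conv[OF that] by (simp add: p_def convergent_LIMSEQ_iff)
  have p0: "p C \<ge> 0" if "C \<in> local_sets" for C
    by (rule LIMSEQ_le_const[OF p[OF that]]) auto
  interpret L: algebra UNIV local_sets by (rule algebra_local_sets)
  have "p {} = 0" by (simp add: p_def)
  have "\<exists>m. (\<forall>s\<in>local_sets. m s = ennreal (p s)) \<and> measure_space UNIV (sigma_sets UNIV local_sets) m"
  proof (rule L.caratheodory_empty_continuous)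
    show "positive local_sets (\<lambda>C. ennreal (p C))"
      by (simp add: positive_def \<open>p {} = 0\<close>)
    show "additive local_sets (\<lambda>C. ennreal (p C))"
      unfolding additive_def
    proof (intro ballI impI)
      fix A B assume AB: "A \<in> local_sets" "B \<in> local_sets" "A \<inter> B = {}"
      have "(\<lambda>t. measure (M t) (A \<union> B)) = (\<lambda>t. measure (M t) A + measure (M t) B)"
        using AB by (intro ext finite_measure.finite_measure_Union[OF fM]) (auto simp: sM local_borel)
      then have "(\<lambda>t. measure (M t) (A \<union> B)) \<longlonglongrightarrow> p A + p B"
        using tendsto_add[OF p p] AB by simp
      moreover have "A \<union> B \<in> local_sets" using AB by blast
      ultimately have "p (A \<union> B) = p A + p B" using p LIMSEQ_unique by blast
      then show "ennreal (p (A \<union> B)) = ennreal (p A) + ennreal (p B)"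
        using p0 AB by simp
    qed
    show "(\<lambda>i. ennreal (p (A i))) \<longlonglongrightarrow> 0"
      if A: "range A \<subseteq> local_sets" "decseq A" "(\<Inter>i. A i) = {}" for A :: "nat \<Rightarrow> config set"
    proof -
      obtain n where "A n = {}" using decseq_local_empty[OF A] by auto
      then have "A i = {}" if "i \<ge> n" for i using A(2) that by (metis decseqD subset_empty)
      then have "eventually (\<lambda>i. ennreal (p (A i)) = 0) sequentially"
        using \<open>p {} = 0\<close> by (metis (mono_tags, lifting) eventually_sequentiallyI ennreal_0)
      then show ?thesis by (rule tendsto_eventually)
    qed
  qed auto
  then obtain m where m: "\<And>s. s \<in> local_sets \<Longrightarrow> m s = ennreal (p s)"
    and ms: "measure_space UNIV (sets (borel :: config measure)) m"
    unfolding sigma_sets_local by auto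
  define N where "N = measure_of UNIV (sets (borel :: config measure)) m"
  have sN [measurable_cong]: "sets N = sets borel"
    using sets.sigma_sets_eq[of "borel :: config measure"] by (simp add: N_def)
  have spN: "space N = UNIV" using sets_eq_imp_space_eq[OF sN] by simp
  have eN: "emeasure N C = ennreal (p C)" if "C \<in> local_sets" for C
    unfolding N_def using ms that m local_borel
    by (subst emeasure_measure_of_sigma) (auto simp: measure_space_def)
  have "UNIV \<in> local_sets" by (rule L.top)
  have "p UNIV = 1"
    unfolding p_def using prob_space.prob_space[OF pM] spM by simp
  then interpret N: prob_space N
    using eN[OF \<open>UNIV \<in> local_sets\<close>] by (intro prob_spaceI) (simp add: spN)
  have mN: "measure N C = p C" if "C \<in> local_sets" for C
    using eN[OF that] p0[OF that] by (simp add: measure_def)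
  have "(\<lambda>n. \<integral>x. f x \<partial>M n) \<longlonglongrightarrow> (\<integral>x. f x \<partial>N)"
    if f: "continuous_on UNIV f" "bounded (range f)" for f :: "config \<Rightarrow> real"
  proof -
    have fb: "f \<in> borel_measurable borel" using f(1) by (rule borel_measurable_continuous_onI)
    obtain b where b: "\<And>x. \<bar>f x\<bar> \<le> b" using f(2) by (auto simp: bounded_iff)
    have approx: "\<exists>h l. (\<lambda>n. h n) \<longlonglongrightarrow> l \<and> (\<forall>n. \<bar>(\<integral>x. f x \<partial>M n) - h n\<bar> \<le> e) \<and> \<bar>(\<integral>x. f x \<partial>N) - l\<bar> \<le> e"
      if e: "e > 0" for e :: real
    proof -
      obtain S where S: "finite S" "\<And>\<eta> \<zeta>. \<forall>i\<in>S. \<eta> i = \<zeta> i \<Longrightarrow> \<bar>f \<eta> - f \<zeta>\<bar> < e"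
        using uniformly_local[OF f(1) e] by metis
      \<comment> \<open>The cells of the partition of the space by the occupied part
        \<open>T\<close> of \<open>S\<close>. The approximation \<open>g\<close> evaluates
        \<open>f\<close> at the configuration that agrees with the given one on \<open>S\<close> and
        is empty elsewhere.\<close>
      define C where "C T = {\<eta> :: config. {i\<in>S. \<eta> i} = T}" for T
      define g where "g \<eta> = (\<Sum>T\<in>Pow S. f (\<lambda>i. i \<in> T) * indicator (C T) \<eta>)" for \<eta>
      have C: "C T \<in> local_sets" for T
      proof -
        have "depends_on S (C T)" unfolding depends_on_def C_def by auto
        then show ?thesis using S(1) by (auto simp: local_sets_def)
      qed
      have g: "g \<eta> = f (\<lambda>i. i \<in> S \<and> \<eta> i)" for \<eta>
      proof -
        have "g \<eta> = (\<Sum>T\<in>Pow S. if T = {i\<in>S. \<eta> i} then f (\<lambda>i. i \<in> T) else 0)"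
          unfolding g_def by (intro sum.cong) (auto simp: C_def)
        then show ?thesis using S(1) by (simp add: sum.delta)
      qed
      have fg: "\<bar>f \<eta> - g \<eta>\<bar> \<le> e" for \<eta>
        unfolding g by (rule less_imp_le[OF S(2)]) simp
      have int: "(\<integral>x. g x \<partial>P) = (\<Sum>T\<in>Pow S. f (\<lambda>i. i \<in> T) * measure P (C T))"
        "\<bar>(\<integral>x. f x \<partial>P) - (\<integral>x. g x \<partial>P)\<bar> \<le> e"
        if P: "prob_space P" and sP [measurable_cong]: "sets P = sets borel" for P
      proof -
        interpret prob_space P by fact
        have [measurable]: "C T \<in> sets P" for T using C local_borel sP by simp
        have [measurable]: "f \<in> borel_measurable P" using fb by measurable
        have i: "integrable P (\<lambda>x. f (\<lambda>i. i \<in> T) * indicator (C T) x)" for T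
          by (intro integrable_mult_right integrable_real_indicator) (auto simp: emeasure_finite less_top[symmetric])
        show "(\<integral>x. g x \<partial>P) = (\<Sum>T\<in>Pow S. f (\<lambda>i. i \<in> T) * measure P (C T))"
          unfolding g_def using i by (subst Bochner_Integration.integral_sum) auto
        have gi: "integrable P g" unfolding g_def using i by (intro Bochner_Integration.integrable_sum) auto
        have fi: "integrable P f" by (rule integrable_const_bound[of _ b]) (use b in auto)
        have "\<bar>(\<integral>x. f x \<partial>P) - (\<integral>x. g x \<partial>P)\<bar> = \<bar>\<integral>x. f x - g x \<partial>P\<bar>"
          using fi gi by simp
        also have "\<dots> \<le> (\<integral>x. \<bar>f x - g x\<bar> \<partial>P)" by (rule integral_abs_bound)
        also have "\<dots> \<le> (\<integral>x. e \<partial>P)" using fi gi fg by (intro integral_mono) auto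
        finally show "\<bar>(\<integral>x. f x \<partial>P) - (\<integral>x. g x \<partial>P)\<bar> \<le> e" by (simp add: prob_space)
      qed
      have "(\<lambda>n. \<integral>x. g x \<partial>M n) \<longlonglongrightarrow> (\<integral>x. g x \<partial>N)"
        unfolding int(1)[OF pM sM] int(1)[OF N.prob_space_axioms sN] mN[OF C]
        by (intro tendsto_intros p C)
      then show ?thesis using int(2)[OF pM sM] int(2)[OF N.prob_space_axioms sN] by blast
    qed
    show ?thesis
    proof (rule LIMSEQ_I)
      fix r :: real assume "r > 0"
      then obtain h l where hl: "h \<longlonglongrightarrow> l" "\<And>n. \<bar>(\<integral>x. f x \<partial>M n) - h n\<bar> \<le> r / 4"
        "\<bar>(\<integral>x. f x \<partial>N) - l\<bar> \<le> r / 4" using approx[of "r / 4"] by auto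
      obtain n0 where n0: "\<And>n. n \<ge> n0 \<Longrightarrow> \<bar>h n - l\<bar> < r / 4"
        using LIMSEQ_D[OF hl(1), of "r / 4"] \<open>r > 0\<close> by auto
      have "norm ((\<integral>x. f x \<partial>M n) - (\<integral>x. f x \<partial>N)) < r" if "n \<ge> n0" for n
        using hl(2)[of n] hl(3) n0[OF that] \<open>r > 0\<close> unfolding real_norm_def by linarith
      then show "\<exists>no. \<forall>n\<ge>no. norm ((\<integral>x. f x \<partial>M n) - (\<integral>x. f x \<partial>N)) < r" by blast
    qed
  qed
  then show ?thesis
    using N.prob_space_axioms sN by (auto simp: config_measure_def converges_weakly_def)
qed

section \<open>Permanently empty or moving occupied sites\<close>

abbreviation evol :: "nat \<Rightarrow> config \<Rightarrow> config" where
  "evol t \<equiv> ftasep_step ^^ t"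

lemma measurable_evol_eval [measurable]: "(\<lambda>\<eta>. evol t \<eta> i) \<in> borel \<rightarrow>\<^sub>M count_space UNIV"
  by (rule measurable_compose[OF measurable_ftasep_steps measurable_eval])

lemma translate_apply [simp]: "translate k \<eta> i = \<eta> (i - k)"
  by (simp add: translate_def)

section \<open>Translations and particle counts\<close>

lemma step_translate: "ftasep_step (translate k \<eta>) = translate k (ftasep_step \<eta>)"
  by (auto simp: fun_eq_iff ftasep_step_def jumps_def algebra_simps)

lemma evol_translate: "evol t (translate k \<eta>) = translate k (evol t \<eta>)"
proof (induction t)
  case (Suc t)
  then show ?case by (simp only: funpow.simps comp_apply step_translate)
qed simp

text \<open>Open on the left, so that one step gains \<open>jumps \<eta> a\<close> and loses
  \<open>jumps \<eta> b\<close>: both ends are treated alike.\<close>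

definition particles :: "config \<Rightarrow> int \<Rightarrow> int \<Rightarrow> int" where
  "particles \<eta> a b = (\<Sum>i\<in>{a<..b}. of_bool (\<eta> i))"

lemma particles_Suc: "a \<le> b \<Longrightarrow> particles \<eta> a (b + 1) = particles \<eta> a b + of_bool (\<eta> (b + 1))"
proof -
  assume "a \<le> b"
  then have "{a<..b + 1} = insert (b + 1) {a<..b}" by auto
  then show ?thesis by (simp add: particles_def)
qed

lemma particles_bounds: "0 \<le> particles \<eta> a b" "particles \<eta> a b \<le> of_nat (nat (b - a))"
proof -
  show "0 \<le> particles \<eta> a b" unfolding particles_def by (rule sum_nonneg) simp
  have "particles \<eta> a b \<le> (\<Sum>i\<in>{a<..b}. 1)" unfolding particles_def by (rule sum_mono) simp
  then show "particles \<eta> a b \<le> of_nat (nat (b - a))" by simp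
qed

lemma particles_shift:
  assumes "a \<le> b"
  shows "particles \<eta> (a - 1) (b - 1) = particles \<eta> a b + of_bool (\<eta> a) - of_bool (\<eta> b)"
proof -
  have "a - 1 \<le> b - 1" using assms by simp
  have "{a - 1<..b} = insert a {a<..b}" using assms by auto
  then have "particles \<eta> (a - 1) b = particles \<eta> a b + of_bool (\<eta> a)" by (simp add: particles_def)
  moreover have "particles \<eta> (a - 1) b = particles \<eta> (a - 1) (b - 1) + of_bool (\<eta> b)"
    using particles_Suc[of "a - 1" "b - 1" \<eta>] assms by simp
  ultimately show ?thesis by simp
qed

lemma particles_step:
  assumes "a \<le> b"
  shows "particles (ftasep_step \<eta>) a b = particles \<eta> a b + of_bool (jumps \<eta> a) - of_bool (jumps \<eta> b)"
  using assms
proof (induction b rule: int_ge_induct)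
  case base
  then show ?case by (simp add: particles_def)
next
  case (step i)
  have "of_bool (ftasep_step \<eta> (i + 1)) =
    (of_bool (\<eta> (i + 1)) + of_bool (jumps \<eta> i) - of_bool (jumps \<eta> (i + 1)) :: int)"
    by (auto simp: ftasep_step_def jumps_def)
  with step show ?case by (simp add: particles_Suc)
qed

lemma eventually_const_of_decreasing:
  fixes f :: "nat \<Rightarrow> int"
  assumes "\<And>t. f (Suc t) \<le> f t" "\<And>t. f t \<ge> c"
  shows "\<exists>l. eventually (\<lambda>t. f t = l) sequentially"
proof -
  obtain T where T: "\<And>t. nat (f T - c) \<le> nat (f t - c)"
    using ex_has_least_nat[of "\<lambda>_. True" 0 "\<lambda>t. nat (f t - c)"] by auto
  have "decseq f" using assms(1) by (rule decseq_SucI)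
  have "f t = f T" if "t \<ge> T" for t
    using T[of t] assms(2)[of t] assms(2)[of T] decseqD[OF \<open>decseq f\<close> that] by linarith
  then show ?thesis by (auto simp: eventually_sequentially)
qed

text \<open>No particle ever crosses a permanently empty site, so the number of particles between it and
  any site to its right can only decrease.\<close>
lemma eventually_const_right_of_hole:
  assumes "\<And>t. \<not> evol t \<eta> j" "j < k"
  shows "\<exists>b. eventually (\<lambda>t. evol t \<eta> k = b) sequentially"
proof -
  have *: "\<exists>l. eventually (\<lambda>t. particles (evol t \<eta>) j i = l) sequentially" if "j \<le> i" for i
  proof (rule eventually_const_of_decreasing)
    show "particles (evol (Suc t) \<eta>) j i \<le> particles (evol t \<eta>) j i" for t
      using particles_step[OF that, of "evol t \<eta>"] assms(1)[of t] by (simp add: jumps_def)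
  qed (rule particles_bounds)
  obtain l l' where "eventually (\<lambda>t. particles (evol t \<eta>) j k = l) sequentially"
    "eventually (\<lambda>t. particles (evol t \<eta>) j (k - 1) = l') sequentially"
    using *[of k] *[of "k - 1"] assms(2) by auto
  \<comment> \<open>The occupation of \<open>k\<close> is the difference of two counts that both
    become constant.\<close>
  then have "eventually (\<lambda>t. evol t \<eta> k = (l - l' = 1)) sequentially"
  proof eventually_elim
    case (elim t)
    then show ?case using particles_Suc[of j "k - 1" "evol t \<eta>"] assms(2) by simp
  qed
  then show ?thesis by blast
qed

text \<open>In the frame moving left at unit speed the current through any site is at most one, and it
  equals one at a permanently occupied site.\<close>
lemma eventually_const_right_of_moving_particle:
  assumes "\<And>t. evol t \<eta> (h - int t)" "h < k"
  shows "\<exists>b. eventually (\<lambda>t. evol t \<eta> (k - int t) = b) sequentially"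
proof -
  \<comment> \<open>Here the count increases and is bounded by the fixed length of the interval; the
    minus sign turns it into a decreasing sequence.\<close>
  have *: "\<exists>l. eventually (\<lambda>t. - particles (evol t \<eta>) (h - int t) (i - int t) = l) sequentially" if "h \<le> i" for i
  proof (rule eventually_const_of_decreasing)
    fix t
    let ?a = "h - int t" and ?b = "i - int t" and ?e = "evol t \<eta>"
    have "particles (evol (Suc t) \<eta>) (h - int (Suc t)) (i - int (Suc t)) = particles (ftasep_step ?e) (?a - 1) (?b - 1)"
      by (simp add: algebra_simps)
    also have "\<dots> = particles ?e ?a ?b + of_bool (?e ?a) - of_bool (?e ?b)
        + of_bool (jumps ?e (?a - 1)) - of_bool (jumps ?e (?b - 1))"
      using that by (subst particles_step) (simp_all add: particles_shift)
    \<comment> \<open>The occupied \<open>?a\<close> contributes 1. The loss at \<open>?b\<close> is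
      at most 1, since a jump out of \<open>?b - 1\<close> requires \<open>?b\<close> to be
      empty.\<close>
    also have "\<dots> \<ge> particles ?e ?a ?b"
      using assms(1)[of t] by (simp add: jumps_def)
    finally show "- particles (evol (Suc t) \<eta>) (h - int (Suc t)) (i - int (Suc t)) \<le> - particles ?e ?a ?b"
      by simp
    show "- particles ?e ?a ?b \<ge> - int (nat (i - h))"
      using particles_bounds(2)[of ?e ?a ?b] by simp
  qed
  obtain l l' where "eventually (\<lambda>t. - particles (evol t \<eta>) (h - int t) (k - int t) = l) sequentially"
    "eventually (\<lambda>t. - particles (evol t \<eta>) (h - int t) (k - 1 - int t) = l') sequentially"
    using *[of k] *[of "k - 1"] assms(2) by auto
  then have "eventually (\<lambda>t. evol t \<eta> (k - int t) = (l' - l = 1)) sequentially"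
  proof eventually_elim
    case (elim t)
    have "k - 1 - int t + 1 = k - int t" by simp
    then show ?case using elim particles_Suc[of "h - int t" "k - 1 - int t" "evol t \<eta>"] assms(2)
      by (auto simp: of_bool_def split: if_splits)
  qed
  then show ?thesis by blast
qed

lemma eventually_const_local:
  assumes "C \<in> local_sets" "\<And>k. \<exists>b. eventually (\<lambda>t. f t k = b) sequentially"
  shows "\<exists>b. eventually (\<lambda>t :: nat. (f t \<in> C) = b) sequentially"
proof -
  obtain S where S: "finite S" "depends_on S C" using assms(1) by (auto simp: local_sets_def)
  obtain z where "\<And>k. eventually (\<lambda>t. f t k = z k) sequentially" using assms(2) by metis
  then have "eventually (\<lambda>t. \<forall>k\<in>S. f t k = z k) sequentially"
    using S(1) by (simp add: eventually_ball_finite)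
  then have "eventually (\<lambda>t. (f t \<in> C) = (z \<in> C)) sequentially"
    by eventually_elim (use S(2) in \<open>auto simp: depends_on_def\<close>)
  then show ?thesis by blast
qed

section \<open>Translation invariant finite measures and mass transport\<close>

locale inv_measure = finite_measure \<nu> for \<nu> :: "config measure" +
  assumes sets_eq [measurable_cong]: "sets \<nu> = sets borel"
    and distr_translate: "distr \<nu> borel (translate k) = \<nu>"
begin

lemma space_eq [simp]: "space \<nu> = UNIV"
  using sets_eq_imp_space_eq[OF sets_eq] by simp

lemma measure_translate:
  assumes "Measurable.pred borel P"
  shows "measure \<nu> {\<eta>. P (translate k \<eta>)} = measure \<nu> {\<eta>. P \<eta>}"
proof -
  have [measurable]: "Measurable.pred borel P" by fact
  have "measure \<nu> {\<eta>. P \<eta>} = measure (distr \<nu> borel (translate k)) {\<eta>. P \<eta>}"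
    by (simp add: distr_translate)
  also have "\<dots> = measure \<nu> (translate k -` {\<eta>. P \<eta>} \<inter> space \<nu>)"
    by (rule measure_distr) measurable
  finally show ?thesis by (simp add: vimage_def)
qed

lemma tendsto_measure:
  fixes E :: "nat \<Rightarrow> config set"
  assumes [measurable]: "\<And>t. E t \<in> sets borel" "L \<in> sets borel"
    and "AE \<eta> in \<nu>. eventually (\<lambda>t. \<eta> \<in> E t \<longleftrightarrow> \<eta> \<in> L) sequentially"
  shows "(\<lambda>t. measure \<nu> (E t)) \<longlonglongrightarrow> measure \<nu> L"
proof -
  have "(\<lambda>t. \<integral>\<eta>. indicator (E t) \<eta> \<partial>\<nu>) \<longlonglongrightarrow> (\<integral>\<eta>. (indicator L \<eta> :: real) \<partial>\<nu>)"
  proof (rule integral_dominated_convergence[where w = "\<lambda>_. 1"])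
    show "AE \<eta> in \<nu>. (\<lambda>t. indicator (E t) \<eta>) \<longlonglongrightarrow> (indicator L \<eta> :: real)"
      using assms(3)
    proof (rule eventually_mono)
      fix \<eta> assume "eventually (\<lambda>t. \<eta> \<in> E t \<longleftrightarrow> \<eta> \<in> L) sequentially"
      then have "eventually (\<lambda>t. indicator (E t) \<eta> = (indicator L \<eta> :: real)) sequentially"
        by (rule eventually_mono) (simp add: indicator_def)
      then show "(\<lambda>t. indicator (E t) \<eta>) \<longlonglongrightarrow> (indicator L \<eta> :: real)"
        by (rule tendsto_eventually)
    qed
  qed (auto simp: indicator_def)
  then show ?thesis by (simp add: sets_eq)
qed

lemma convergent_measure:
  assumes [measurable]: "\<And>t. E t \<in> sets borel"
    and "AE \<eta> in \<nu>. \<exists>b. eventually (\<lambda>t. (\<eta> \<in> E t) = b) sequentially"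
  shows "convergent (\<lambda>t :: nat. measure \<nu> (E t))"
proof -
  \<comment> \<open>The limit inferior of the events, a measurable substitute for the value
    \<open>b\<close> that depends on the configuration.\<close>
  define L where "L = {\<eta>. \<exists>T. \<forall>t\<ge>T. \<eta> \<in> E t}"
  have [measurable]: "L \<in> sets borel" unfolding L_def by measurable
  have "AE \<eta> in \<nu>. eventually (\<lambda>t. \<eta> \<in> E t \<longleftrightarrow> \<eta> \<in> L) sequentially"
    using assms(2)
  proof eventually_elim
    case (elim \<eta>)
    then obtain b T where T: "\<And>t. t \<ge> T \<Longrightarrow> (\<eta> \<in> E t) = b" by (auto simp: eventually_sequentially)
    then have "b \<longleftrightarrow> \<eta> \<in> L" unfolding L_def by (auto) (meson nle_le)
    with T show ?case by (auto simp: eventually_sequentially)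
  qed
  then have "(\<lambda>t. measure \<nu> (E t)) \<longlonglongrightarrow> measure \<nu> L"
    by (intro tendsto_measure) auto
  then show ?thesis by (auto simp: convergent_def)
qed

text \<open>A finite measure has no room for infinitely many disjoint translates of a non-null event,
  such as \<^term>\<open>k\<close> being the extreme point of the random set.\<close>
lemma AE_unbounded:
  fixes A :: "config \<Rightarrow> int \<Rightarrow> bool" and s :: int
  assumes s: "s = 1 \<or> s = -1"
    and [measurable]: "\<And>i. Measurable.pred borel (\<lambda>\<eta>. A \<eta> i)"
    and cov: "\<And>k \<eta> i. A (translate k \<eta>) i = A \<eta> (i - k)"
  shows "AE \<eta> in \<nu>. (\<exists>i. A \<eta> i) \<longrightarrow> (\<forall>k. \<exists>i. s * i < s * k \<and> A \<eta> i)"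
proof -
  \<comment> \<open>On \<open>B k\<close> the random set has \<open>k\<close> as its leftmost point
    if \<open>s = 1\<close> and as its rightmost point if \<open>s = -1\<close>.\<close>
  define B where "B k = {\<eta>. A \<eta> k \<and> (\<forall>i. s * i < s * k \<longrightarrow> \<not> A \<eta> i)}" for k
  have B [measurable]: "B k \<in> sets borel" for k unfolding B_def by measurable
  have eq: "measure \<nu> (B k) = measure \<nu> (B 0)" for k
  proof -
    have "(\<forall>i. s * i < 0 \<longrightarrow> \<not> A \<eta> (i + k)) \<longleftrightarrow> (\<forall>i. s * i < s * k \<longrightarrow> \<not> A \<eta> i)" for \<eta>
      by (metis (no_types, opaque_lifting) add_diff_cancel_right' diff_add_cancel diff_less_0_iff_less right_diff_distrib)
    then have "B k = {\<eta>. translate (- k) \<eta> \<in> B 0}"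
      by (simp add: B_def cov)
    then show ?thesis using measure_translate[of "\<lambda>\<eta>. \<eta> \<in> B 0" "- k"] by simp
  qed
  have "disjoint_family (\<lambda>n. B (int n))"
    unfolding disjoint_family_on_def
  proof (intro ballI impI)
    fix m n :: nat assume "m \<noteq> n"
    then have "s * int m < s * int n \<or> s * int n < s * int m" using s by auto
    then show "B (int m) \<inter> B (int n) = {}" by (auto simp: B_def)
  qed
  then have "(\<lambda>n. measure \<nu> (B (int n))) sums measure \<nu> (\<Union>n. B (int n))"
    by (intro finite_measure_UNION) (auto simp: sets_eq)
  then have "(\<lambda>n :: nat. measure \<nu> (B 0)) \<longlonglongrightarrow> 0"
    unfolding eq[of "int _"] by (intro summable_LIMSEQ_zero sums_summable)
  then have "measure \<nu> (B 0) = 0" by (simp add: LIMSEQ_const_iff)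
  then have "AE \<eta> in \<nu>. \<eta> \<notin> B k" for k
    using eq[of k] by (intro AE_not_in) (auto simp: null_sets_def emeasure_eq_measure sets_eq)
  then have "AE \<eta> in \<nu>. \<forall>k. \<eta> \<notin> B k" by (simp add: AE_all_countable)
  then show ?thesis
  proof eventually_elim
    case (elim \<eta>)
    show ?case
    proof (intro impI allI, rule ccontr)
      fix k assume "\<exists>i. A \<eta> i" and no: "\<nexists>i. s * i < s * k \<and> A \<eta> i"
      then obtain i where "A \<eta> i" by blast
      then obtain m where m: "A \<eta> m" "\<And>y. A \<eta> y \<Longrightarrow> nat (s * m - s * k) \<le> nat (s * y - s * k)"
        using ex_has_least_nat[of "A \<eta>" i "\<lambda>i. nat (s * i - s * k)"] by blast
      have "\<not> A \<eta> i" if "s * i < s * m" for i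
      proof
        assume "A \<eta> i"
        then have "nat (s * m - s * k) \<le> nat (s * i - s * k)" "s * k \<le> s * i" "s * k \<le> s * m"
          using m no by (auto simp: not_less[symmetric])
        then show False using that by linarith
      qed
      then have "\<eta> \<in> B m" using m(1) by (auto simp: B_def)
      then show False using elim by blast
    qed
  qed
qed

text \<open>By invariance, 0 sends to \<open>j\<close> with the same probability as
  \<open>- j\<close> sends to 0. Summing over \<open>j\<close> gives both sides, because a site has
  at most one receiver and at most one sender, which makes both unions disjoint.\<close>

lemma mass_transport_everywhere:
  fixes R :: "config \<Rightarrow> int \<Rightarrow> int \<Rightarrow> bool"
  assumes R [measurable]: "\<And>i j. Measurable.pred borel (\<lambda>\<eta>. R \<eta> i j)"
    and cov: "\<And>k \<eta> i j. R (translate k \<eta>) i j = R \<eta> (i - k) (j - k)"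
    and inj: "\<And>\<eta> i j j'. R \<eta> i j \<Longrightarrow> R \<eta> i j' \<Longrightarrow> j = j'"
    and inj': "\<And>\<eta> i i' j. R \<eta> i j \<Longrightarrow> R \<eta> i' j \<Longrightarrow> i = i'"
  shows "measure \<nu> {\<eta>. \<exists>j. R \<eta> 0 j} = measure \<nu> {\<eta>. \<exists>i. R \<eta> i 0}"
proof -
  have "{\<eta>. \<exists>j. R \<eta> 0 j} = (\<Union>j. {\<eta>. R \<eta> 0 j})" by auto
  also have "emeasure \<nu> \<dots> = (\<integral>\<^sup>+j. emeasure \<nu> {\<eta>. R \<eta> 0 j} \<partial>count_space UNIV)"
    by (rule emeasure_UN_countable) (auto simp: disjoint_family_on_def sets_eq dest: inj)
  also have "\<dots> = (\<integral>\<^sup>+j. emeasure \<nu> {\<eta>. R \<eta> (- j) 0} \<partial>count_space UNIV)"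
  proof (rule nn_integral_cong)
    show "emeasure \<nu> {\<eta>. R \<eta> 0 j} = emeasure \<nu> {\<eta>. R \<eta> (- j) 0}" for j
      using measure_translate[OF R, of j 0 j] by (simp add: emeasure_eq_measure cov)
  qed
  also have "\<dots> = (\<integral>\<^sup>+i. emeasure \<nu> {\<eta>. R \<eta> i 0} \<partial>count_space UNIV)"
    by (rule nn_integral_bij_count_space[where g = uminus]) (auto intro!: bijI injI surjI[where f = uminus])
  also have "\<dots> = emeasure \<nu> (\<Union>i. {\<eta>. R \<eta> i 0})"
    by (rule emeasure_UN_countable[symmetric]) (auto simp: disjoint_family_on_def sets_eq dest: inj')
  also have "(\<Union>i. {\<eta>. R \<eta> i 0}) = {\<eta>. \<exists>i. R \<eta> i 0}" by auto
  finally show ?thesis by (simp add: measure_def)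
qed

text \<open>The set \<open>G\<close> on which \<open>R\<close> is a partial injection is translation
  invariant, so cutting \<open>R\<close> off outside \<open>G\<close> keeps it covariant and changes
  only null sets.\<close>

lemma mass_transport:
  fixes R :: "config \<Rightarrow> int \<Rightarrow> int \<Rightarrow> bool"
  assumes [measurable]: "\<And>i j. Measurable.pred borel (\<lambda>\<eta>. R \<eta> i j)"
    and cov: "\<And>k \<eta> i j. R (translate k \<eta>) i j = R \<eta> (i - k) (j - k)"
    and inj: "AE \<eta> in \<nu>. \<forall>i j j'. R \<eta> i j \<longrightarrow> R \<eta> i j' \<longrightarrow> j = j'"
    and inj': "AE \<eta> in \<nu>. \<forall>i i' j. R \<eta> i j \<longrightarrow> R \<eta> i' j \<longrightarrow> i = i'"
  shows "measure \<nu> {\<eta>. \<exists>j. R \<eta> 0 j} = measure \<nu> {\<eta>. \<exists>i. R \<eta> i 0}"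
proof -
  define G where "G \<eta> \<longleftrightarrow> (\<forall>i j j'. R \<eta> i j \<longrightarrow> R \<eta> i j' \<longrightarrow> j = j') \<and> (\<forall>i i' j. R \<eta> i j \<longrightarrow> R \<eta> i' j \<longrightarrow> i = i')" for \<eta>
  have [measurable]: "Measurable.pred borel G" unfolding G_def by measurable
  have Gcov: "G (translate k \<eta>) = G \<eta>" for k \<eta>
  proof -
    have *: "G (translate k \<eta>)" if "G \<eta>" for k \<eta>
      unfolding G_def cov
    proof (intro conjI allI impI)
      fix i j j' assume "R \<eta> (i - k) (j - k)" "R \<eta> (i - k) (j' - k)"
      then have "j - k = j' - k" using that unfolding G_def by blast
      then show "j = j'" by simp
    next
      fix i i' j assume "R \<eta> (i - k) (j - k)" "R \<eta> (i' - k) (j - k)"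
      then have "i - k = i' - k" using that unfolding G_def by blast
      then show "i = i'" by simp
    qed
    have "translate (- k) (translate k \<eta>) = \<eta>" by (simp add: fun_eq_iff)
    then show ?thesis using *[of \<eta> k] *[of "translate k \<eta>" "- k"] by auto
  qed
  have G: "AE \<eta> in \<nu>. G \<eta>" using inj inj' by eventually_elim (simp add: G_def)
  have "measure \<nu> {\<eta>. \<exists>j. R \<eta> 0 j \<and> G \<eta>} = measure \<nu> {\<eta>. \<exists>i. R \<eta> i 0 \<and> G \<eta>}"
  proof (rule mass_transport_everywhere)
    show "(R (translate k \<eta>) i j \<and> G (translate k \<eta>)) = (R \<eta> (i - k) (j - k) \<and> G \<eta>)" for k \<eta> i j
      by (simp only: cov Gcov)
  qed (measurable, auto simp: G_def)
  moreover have "measure \<nu> {\<eta>. \<exists>j. R \<eta> 0 j \<and> G \<eta>} = measure \<nu> {\<eta>. \<exists>j. R \<eta> 0 j}"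
    by (rule measure_eq_AE) (use G in auto)
  moreover have "measure \<nu> {\<eta>. \<exists>i. R \<eta> i 0 \<and> G \<eta>} = measure \<nu> {\<eta>. \<exists>i. R \<eta> i 0}"
    by (rule measure_eq_AE) (use G in auto)
  ultimately show ?thesis by simp
qed

section \<open>The two cases with pointwise convergence\<close>

lemma convergent_if_hole:
  assumes "AE \<eta> in \<nu>. \<exists>j. \<forall>t. \<not> evol t \<eta> j" and C: "C \<in> local_sets"
  shows "convergent (\<lambda>t. measure \<nu> {\<eta>. evol t \<eta> \<in> C})"
proof (rule convergent_measure)
  have [measurable]: "C \<in> sets borel" using C by (rule local_borel)
  show "{\<eta>. evol t \<eta> \<in> C} \<in> sets borel" for t by measurable
  have "AE \<eta> in \<nu>. (\<exists>j. \<forall>t. \<not> evol t \<eta> j) \<longrightarrow> (\<forall>k. \<exists>j. 1 * j < 1 * k \<and> (\<forall>t. \<not> evol t \<eta> j))"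
    by (rule AE_unbounded) (auto simp: evol_translate)
  with assms(1) show "AE \<eta> in \<nu>. \<exists>b. eventually (\<lambda>t. (\<eta> \<in> {\<eta>. evol t \<eta> \<in> C}) = b) sequentially"
  proof eventually_elim
    case (elim \<eta>)
    have "\<exists>b. eventually (\<lambda>t. (evol t \<eta> \<in> C) = b) sequentially"
    proof (rule eventually_const_local[OF C])
      fix k
      have "\<exists>j<k. \<forall>t. \<not> evol t \<eta> j" using elim by simp
      then obtain j where "j < k" "\<forall>t. \<not> evol t \<eta> j" by blast
      then show "\<exists>b. eventually (\<lambda>t. evol t \<eta> k = b) sequentially"
        by (intro eventually_const_right_of_hole) auto
    qed
    then show ?case by simp
  qed
qed

lemma convergent_if_moving_particle:
  assumes "AE \<eta> in \<nu>. \<exists>j. \<forall>t. evol t \<eta> (j - int t)" and C: "C \<in> local_sets"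
  shows "convergent (\<lambda>t. measure \<nu> {\<eta>. evol t \<eta> \<in> C})"
proof -
  have [measurable]: "C \<in> sets borel" using C by (rule local_borel)
  have "AE \<eta> in \<nu>. (\<exists>j. \<forall>t. evol t \<eta> (j - int t)) \<longrightarrow> (\<forall>k. \<exists>j. 1 * j < 1 * k \<and> (\<forall>t. evol t \<eta> (j - int t)))"
    by (rule AE_unbounded) (auto simp: evol_translate algebra_simps)
  with assms(1) have "AE \<eta> in \<nu>. \<exists>b. eventually (\<lambda>t. (\<eta> \<in> {\<eta>. translate (int t) (evol t \<eta>) \<in> C}) = b) sequentially"
  proof eventually_elim
    case (elim \<eta>)
    have "\<exists>b. eventually (\<lambda>t. (translate (int t) (evol t \<eta>) \<in> C) = b) sequentially"
    proof (rule eventually_const_local[OF C])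
      fix k
      have "\<exists>j<k. \<forall>t. evol t \<eta> (j - int t)" using elim by simp
      then obtain j where "j < k" "\<forall>t. evol t \<eta> (j - int t)" by blast
      then show "\<exists>b. eventually (\<lambda>t. translate (int t) (evol t \<eta>) k = b) sequentially"
        unfolding translate_apply by (intro eventually_const_right_of_moving_particle) auto
    qed
    then show ?case by simp
  qed
  then have "convergent (\<lambda>t. measure \<nu> {\<eta>. translate (int t) (evol t \<eta>) \<in> C})"
    by (intro convergent_measure) measurable
  \<comment> \<open>The dynamics commutes with translations, so passing to the moving frame does not
    change probabilities at a fixed time.\<close>
  moreover have "measure \<nu> {\<eta>. translate (int t) (evol t \<eta>) \<in> C} = measure \<nu> {\<eta>. evol t \<eta> \<in> C}" for t
    using measure_translate[of "\<lambda>\<eta>. evol t \<eta> \<in> C" "int t"] by (simp add: evol_translate)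
  ultimately show ?thesis by simp
qed

end

section \<open>The word read at the holes\<close>

text \<open>For a hole \<open>h\<close> this is the letter and at the same time the condition
  \<open>jumps \<eta> (h - 1)\<close> under which the hole changes places with the particle on its
  left.\<close>

definition two_left :: "config \<Rightarrow> int \<Rightarrow> bool" where
  "two_left \<eta> h \<longleftrightarrow> \<eta> (h - 1) \<and> \<eta> (h - 2)"

definition hole_pair :: "config \<Rightarrow> int \<Rightarrow> bool" where
  "hole_pair \<eta> j \<longleftrightarrow> \<not> \<eta> j \<and> \<not> \<eta> (j + 1)"

definition triple :: "config \<Rightarrow> int \<Rightarrow> bool" where
  "triple \<eta> j \<longleftrightarrow> \<eta> j \<and> \<eta> (j + 1) \<and> \<eta> (j + 2)"

definition hole_move :: "config \<Rightarrow> int \<Rightarrow> int" where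
  "hole_move \<eta> h = (if two_left \<eta> h then h - 1 else h)"

text \<open>A relation, because a next hole need not exist. It serves directly as a transport
  rule.\<close>

definition next_hole :: "config \<Rightarrow> int \<Rightarrow> int \<Rightarrow> bool" where
  "next_hole \<eta> i j \<longleftrightarrow> i < j \<and> \<not> \<eta> i \<and> \<not> \<eta> j \<and> (\<forall>m. i < m \<longrightarrow> m < j \<longrightarrow> \<eta> m)"

definition holes_unbounded :: "config \<Rightarrow> bool" where
  "holes_unbounded \<eta> \<longleftrightarrow> (\<forall>k. (\<exists>j<k. \<not> \<eta> j) \<and> (\<exists>j>k. \<not> \<eta> j))"

text \<open>One step carries the letter of a hole to the updated position of the next hole.\<close>
definition tag :: "config \<Rightarrow> int \<Rightarrow> int \<Rightarrow> bool" where
  "tag \<eta> i g \<longleftrightarrow> (\<exists>j. next_hole \<eta> i j \<and> g = hole_move \<eta> j)"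

text \<open>The letter of the starting hole itself is not read, so that the word describes the sites to the
  right of this hole only.\<close>
primrec reads :: "config \<Rightarrow> int \<Rightarrow> bool list \<Rightarrow> bool" where
  "reads \<eta> h [] \<longleftrightarrow> \<not> \<eta> h"
| "reads \<eta> h (b # w) \<longleftrightarrow> (\<exists>j. next_hole \<eta> h j \<and> two_left \<eta> j = b \<and> reads \<eta> j w)"

text \<open>The two ways in which the letter of a hole changes while being carried: \<open>1100\<close> loses its hole
  pair, and a \<open>0111\<close> not preceded by \<open>11\<close> loses its triple.\<close>
definition flip :: "config \<Rightarrow> int \<Rightarrow> bool" where
  "flip \<eta> h \<longleftrightarrow> hole_pair \<eta> h \<and> two_left \<eta> h \<or> \<not> \<eta> h \<and> \<not> two_left \<eta> h \<and> triple \<eta> (h + 1)"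

text \<open>Skips \<open>h\<close> itself, just as \<open>reads\<close> skips the letter of its
  starting hole.\<close>

primrec flips :: "config \<Rightarrow> int \<Rightarrow> nat \<Rightarrow> bool" where
  "flips \<eta> h 0 \<longleftrightarrow> False"
| "flips \<eta> h (Suc n) \<longleftrightarrow> (\<exists>j. next_hole \<eta> h j \<and> (flip \<eta> j \<or> flips \<eta> j n))"

text \<open>The right hole of a pair has an empty left neighbour and cannot move, so only a particle
  jumping into \<open>j\<close> breaks the pair. None is created: a particle leaving
  \<open>j\<close> fills \<open>j + 1\<close>, and one leaving \<open>j + 1\<close> needs a particle
  at \<open>j\<close> behind it, which then stays.\<close>

lemma hole_pair_step: "hole_pair (ftasep_step \<eta>) j \<longleftrightarrow> hole_pair \<eta> j \<and> \<not> two_left \<eta> j"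
proof -
  have [simp]: "j - 1 - 1 = j - 2" by simp
  show ?thesis by (auto simp: hole_pair_def two_left_def ftasep_step_def jumps_def)
qed

text \<open>Of three adjacent particles only the last can jump away. The triple therefore continues
  one site further left, provided that \<open>j\<close> is already occupied or is filled by a
  jump.\<close>

lemma triple_step: "triple (ftasep_step \<eta>) j \<longleftrightarrow> triple \<eta> (j + 1) \<and> (\<eta> j \<or> two_left \<eta> j)"
proof -
  have [simp]: "j - 1 - 1 = j - 2" "j + 1 + 1 = j + 2" "j + 2 + 1 = j + 3" "j + 1 + 2 = j + 3" "j + 2 - 1 = j + 1" by simp_all
  show ?thesis by (auto simp: triple_def two_left_def ftasep_step_def jumps_def)
qed

lemma hole_move_hole: "\<not> \<eta> h \<Longrightarrow> \<not> ftasep_step \<eta> (hole_move \<eta> h)"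
proof -
  have [simp]: "h - 1 - 1 = h - 2" by simp
  show "\<not> \<eta> h \<Longrightarrow> \<not> ftasep_step \<eta> (hole_move \<eta> h)"
    by (auto simp: hole_move_def two_left_def ftasep_step_def jumps_def)
qed

lemma hole_move_surj:
  assumes "\<not> ftasep_step \<eta> g"
  obtains h where "\<not> \<eta> h" "g = hole_move \<eta> h"
proof (cases "\<eta> g")
  case True
  then have "jumps \<eta> g" using assms by (simp add: ftasep_step_def)
  then have "\<not> \<eta> (g + 1)" "g = hole_move \<eta> (g + 1)"
    by (auto simp: jumps_def hole_move_def two_left_def)
  then show ?thesis by (rule that)
next
  case False
  have [simp]: "g - 1 - 1 = g - 2" by simp
  have "g = hole_move \<eta> g" using assms False
    by (auto simp: ftasep_step_def jumps_def hole_move_def two_left_def)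
  with False show ?thesis by (rule that)
qed

text \<open>A move covers one site, so only \<open>h' = h + 1\<close> is critical, and there the
  hole at \<open>h\<close> prevents \<open>h'\<close> from moving.\<close>

lemma hole_move_less: "\<not> \<eta> h \<Longrightarrow> h < h' \<Longrightarrow> hole_move \<eta> h < hole_move \<eta> h'"
  by (cases "h' = h + 1") (auto simp: hole_move_def two_left_def)

lemma hole_move_inj: "\<not> \<eta> h \<Longrightarrow> \<not> \<eta> h' \<Longrightarrow> hole_move \<eta> h = hole_move \<eta> h' \<Longrightarrow> h = h'"
  using hole_move_less[of \<eta> h h'] hole_move_less[of \<eta> h' h] by force

text \<open>\<open>hole_move\<close> is an order preserving bijection from the old holes to the new
  ones, so it preserves adjacency.\<close>

lemma next_hole_step:
  assumes "next_hole \<eta> h h'"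
  shows "next_hole (ftasep_step \<eta>) (hole_move \<eta> h) (hole_move \<eta> h')"
  unfolding next_hole_def
proof (intro conjI allI impI)
  have h: "\<not> \<eta> h" "\<not> \<eta> h'" "h < h'" using assms by (auto simp: next_hole_def)
  then show "hole_move \<eta> h < hole_move \<eta> h'" "\<not> ftasep_step \<eta> (hole_move \<eta> h)" "\<not> ftasep_step \<eta> (hole_move \<eta> h')"
    by (simp_all add: hole_move_less hole_move_hole)
  fix m assume m: "hole_move \<eta> h < m" "m < hole_move \<eta> h'"
  show "ftasep_step \<eta> m"
  proof (rule ccontr)
    assume "\<not> ftasep_step \<eta> m"
    then obtain k where k: "\<not> \<eta> k" "m = hole_move \<eta> k" by (rule hole_move_surj)
    then have "\<not> (h < k \<and> k < h')" using assms by (auto simp: next_hole_def)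
    then consider "k = h" | "k < h" | "k = h'" | "h' < k" by linarith
    then show False
      using m k hole_move_less[of \<eta> k h] hole_move_less[of \<eta> h' k] h by cases auto
  qed
qed

lemma next_hole_unique: "next_hole \<eta> i j \<Longrightarrow> next_hole \<eta> i j' \<Longrightarrow> j = j'"
  unfolding next_hole_def by (metis linorder_neqE)

lemma next_hole_inj: "next_hole \<eta> i j \<Longrightarrow> next_hole \<eta> i' j \<Longrightarrow> i = i'"
  unfolding next_hole_def by (metis linorder_neqE)

lemma next_hole_exists:
  assumes "holes_unbounded \<eta>" "\<not> \<eta> i"
  obtains j where "next_hole \<eta> i j"
proof -
  obtain y where "y > i" "\<not> \<eta> y" using assms(1) by (auto simp: holes_unbounded_def)
  then obtain j where j: "j > i" "\<not> \<eta> j" "\<And>y. y > i \<Longrightarrow> \<not> \<eta> y \<Longrightarrow> nat (j - i) \<le> nat (y - i)"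
    using ex_has_least_nat[of "\<lambda>y. y > i \<and> \<not> \<eta> y" y "\<lambda>y. nat (y - i)"] by blast
  have "next_hole \<eta> i j" unfolding next_hole_def using j(1,2) j(3) assms(2) by force
  then show ?thesis by (rule that)
qed

lemma prev_hole_exists:
  assumes "holes_unbounded \<eta>" "\<not> \<eta> j"
  obtains i where "next_hole \<eta> i j"
proof -
  obtain y where "y < j" "\<not> \<eta> y" using assms(1) by (auto simp: holes_unbounded_def)
  then obtain i where i: "i < j" "\<not> \<eta> i" "\<And>y. y < j \<Longrightarrow> \<not> \<eta> y \<Longrightarrow> nat (j - i) \<le> nat (j - y)"
    using ex_has_least_nat[of "\<lambda>y. y < j \<and> \<not> \<eta> y" y "\<lambda>y. nat (j - y)"] by blast
  have "next_hole \<eta> i j" unfolding next_hole_def using i(1,2) i(3) assms(2) by force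
  then show ?thesis by (rule that)
qed

lemma tag_unique: "tag \<eta> i g \<Longrightarrow> tag \<eta> i g' \<Longrightarrow> g = g'"
  unfolding tag_def using next_hole_unique by blast

lemma tag_inj: "tag \<eta> i g \<Longrightarrow> tag \<eta> i' g \<Longrightarrow> i = i'"
  unfolding tag_def by (metis hole_move_inj next_hole_def next_hole_inj)

lemma tag_surj:
  assumes "holes_unbounded \<eta>" "\<not> ftasep_step \<eta> g"
  obtains i where "tag \<eta> i g"
proof -
  obtain h where h: "\<not> \<eta> h" "g = hole_move \<eta> h" using assms(2) by (rule hole_move_surj)
  obtain i where "next_hole \<eta> i h" using assms(1) h(1) by (rule prev_hole_exists)
  then have "tag \<eta> i g" using h by (auto simp: tag_def)
  then show ?thesis by (rule that)
qed

lemma two_left_tag: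
  assumes "next_hole \<eta> h h'" "\<not> flip \<eta> h"
  shows "two_left (ftasep_step \<eta>) (hole_move \<eta> h') \<longleftrightarrow> two_left \<eta> h"
proof -
  have h: "\<not> \<eta> h" "\<not> \<eta> h'" "h < h'" and m: "\<And>m. h < m \<Longrightarrow> m < h' \<Longrightarrow> \<eta> m"
    using assms(1) by (auto simp: next_hole_def)
  have [simp]: "1 + h = h + 1" "2 + h = h + 2" "h - 1 - 1 = h - 2" "h + 1 + 1 = h + 2" "h + 2 + 1 = h + 3" "h + 1 + 2 = h + 3" "h + 2 - 1 = h + 1" by simp_all
  \<comment> \<open>At gaps 2 and 3 the new letter says whether \<open>h\<close> gets filled, which
    is the old letter of \<open>h\<close>. At gap 1 it is always \<open>False\<close> and at gaps
    above 3 always \<open>True\<close>; the two parts of \<open>flip\<close> are the situations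
    where this is wrong.\<close>
  consider "h' = h + 1" | "h' = h + 2" | "h' = h + 3" | "h' > h + 3" using h(3) by linarith
  then show ?thesis
  proof cases
    case 1
    then show ?thesis using h assms(2)
      by (auto simp: flip_def two_left_def hole_move_def hole_pair_def ftasep_step_def jumps_def)
  next
    case 2
    then show ?thesis using h m[of "h + 1"]
      by (auto simp: two_left_def hole_move_def ftasep_step_def jumps_def)
  next
    case 3
    then show ?thesis using h m[of "h + 1"] m[of "h + 2"]
      by (auto simp: two_left_def hole_move_def ftasep_step_def jumps_def)
  next
    case 4
    have [simp]: "h' - 1 - 1 = h' - 2" "h' - 1 - 2 = h' - 3" "h' - 2 + 1 = h' - 1" "h' - 3 + 1 = h' - 2"  by simp_all
    have "\<eta> (h + 1)" "\<eta> (h + 2)" "\<eta> (h + 3)" "\<eta> (h' - 1)" "\<eta> (h' - 2)" "\<eta> (h' - 3)"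
      using 4 by (auto intro!: m)
    then show ?thesis using h assms(2)
      by (auto simp: flip_def triple_def two_left_def hole_move_def ftasep_step_def jumps_def)
  qed
qed

section \<open>How words evolve and what they determine\<close>

lemma reads_Cons_next: "next_hole \<eta> h j \<Longrightarrow> reads \<eta> h (b # w) \<longleftrightarrow> two_left \<eta> j = b \<and> reads \<eta> j w"
  using next_hole_unique by auto

lemma reads_hole: "reads \<eta> h w \<Longrightarrow> \<not> \<eta> h"
  by (cases w) (auto simp: next_hole_def)

text \<open>The tag of \<open>h\<close> arrives at the successor \<open>j\<close>, so the first
  letter read from there after the step sits at the successor \<open>k\<close> of \<open>j\<close>
  and is the one that \<open>j\<close> handed on.\<close>

lemma reads_step:
  assumes "holes_unbounded \<eta>" "tag \<eta> h g" "\<not> flips \<eta> h (length w)"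
  shows "reads (ftasep_step \<eta>) g w \<longleftrightarrow> reads \<eta> h w"
  using assms(2,3)
proof (induction w arbitrary: h g)
  case Nil
  then show ?case by (auto simp: tag_def next_hole_def hole_move_hole)
next
  case (Cons b w)
  obtain j where j: "next_hole \<eta> h j" "g = hole_move \<eta> j" using Cons.prems(1) by (auto simp: tag_def)
  then have "\<not> \<eta> j" by (auto simp: next_hole_def)
  then obtain k where k: "next_hole \<eta> j k" by (rule next_hole_exists[OF assms(1)])
  have nf: "\<not> flip \<eta> j" "\<not> flips \<eta> j (length w)" using Cons.prems(2) j(1) by auto
  have "reads (ftasep_step \<eta>) (hole_move \<eta> k) w \<longleftrightarrow> reads \<eta> j w"
    using k nf by (intro Cons.IH) (auto simp: tag_def)
  moreover have "next_hole (ftasep_step \<eta>) g (hole_move \<eta> k)"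
    unfolding j(2) by (rule next_hole_step[OF k])
  ultimately show ?case
    using reads_Cons_next[OF j(1)] reads_Cons_next[of "ftasep_step \<eta>" g] two_left_tag[OF k nf(1)] by simp
qed

text \<open>Together with \<open>reads_unique\<close> this makes the words of a fixed length a
  partition of the event that there is a hole at \<open>h\<close>.\<close>

lemma reads_exists:
  assumes "holes_unbounded \<eta>" "\<not> \<eta> h"
  shows "\<exists>w. length w = n \<and> reads \<eta> h w"
  using assms(2)
proof (induction n arbitrary: h)
  case (Suc n)
  obtain j where j: "next_hole \<eta> h j" using assms(1) Suc.prems by (rule next_hole_exists)
  then obtain w where "length w = n" "reads \<eta> j w" using Suc.IH by (auto simp: next_hole_def)
  then show ?case using j by (intro exI[of _ "two_left \<eta> j # w"]) auto
qed auto

lemma reads_unique: "reads \<eta> h v \<Longrightarrow> reads \<eta> h w \<Longrightarrow> length v = length w \<Longrightarrow> v = w"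
proof (induction v arbitrary: h w)
  case (Cons b v)
  then obtain c w' where w: "w = c # w'" by (cases w) auto
  obtain j where j: "next_hole \<eta> h j" using Cons.prems by auto
  show ?case using Cons.prems Cons.IH[of j w'] unfolding w reads_Cons_next[OF j] by auto
qed auto

text \<open>Counts where a pattern starts; sites up to \<open>n + 1\<close> can be involved.\<close>

definition unclean :: "config \<Rightarrow> nat \<Rightarrow> bool" where
  "unclean \<eta> n \<longleftrightarrow> (\<exists>m<n. hole_pair \<eta> (int m) \<or> triple \<eta> (int m))"

text \<open>The absence of a pair rules out gap 1 and the absence of a triple rules out gaps above
  3. Of the remaining gaps, only 3 leaves room for two particles to the left of
  \<open>j\<close>.\<close>

lemma next_hole_clean:
  assumes "next_hole \<eta> h j" "\<not> hole_pair \<eta> h" "\<not> triple \<eta> (h + 1)"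
  shows "j = (if two_left \<eta> j then h + 3 else h + 2)"
proof -
  have h: "\<not> \<eta> h" "\<not> \<eta> j" "h < j" and m: "\<And>m. h < m \<Longrightarrow> m < j \<Longrightarrow> \<eta> m"
    using assms(1) by (auto simp: next_hole_def)
  have [simp]: "h + 1 + 1 = h + 2" "h + 1 + 2 = h + 3" by simp_all
  have "j \<noteq> h + 1" using assms(2) h by (auto simp: hole_pair_def)
  moreover have "\<not> j > h + 3" using assms(3) m by (auto simp: triple_def)
  ultimately consider "j = h + 2" | "j = h + 3" using h(3) by linarith
  then show ?thesis by cases (use h m in \<open>auto simp: two_left_def\<close>)
qed

text \<open>Each letter fixes the distance to the next hole and thereby all sites in between. A gap
  is at most 3, hence the clean window of three sites per letter, and more than 1, hence at least
  one site determined per letter.\<close>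

lemma reads_determines:
  assumes "reads \<eta> h w" "reads \<zeta> h w"
    and "\<And>m. h \<le> m \<Longrightarrow> m < h + 3 * int (length w) \<Longrightarrow> \<not> hole_pair \<eta> m \<and> \<not> triple \<eta> m \<and> \<not> hole_pair \<zeta> m \<and> \<not> triple \<zeta> m"
    and "h \<le> i" "i \<le> h + int (length w)"
  shows "\<eta> i = \<zeta> i"
  using assms
proof (induction w arbitrary: h)
  case Nil
  then show ?case by simp
next
  case (Cons b w)
  obtain j k where j: "next_hole \<eta> h j" "two_left \<eta> j = b" "reads \<eta> j w"
    and k: "next_hole \<zeta> h k" "two_left \<zeta> k = b" "reads \<zeta> k w"
    using Cons.prems(1,2) by auto
  have c: "\<not> hole_pair \<eta> m \<and> \<not> triple \<eta> m \<and> \<not> hole_pair \<zeta> m \<and> \<not> triple \<zeta> m"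
    if "h \<le> m" "m < h + 3 * int (length w) + 3" for m
    using Cons.prems(3)[of m] that by simp
  have j': "j = (if b then h + 3 else h + 2)" "k = (if b then h + 3 else h + 2)"
    using next_hole_clean[OF j(1)] next_hole_clean[OF k(1)] j(2) k(2) c[of h] c[of "h + 1"] by auto
  show ?case
  proof (cases "i < j")
    case True
    then show ?thesis using j(1) k(1) j' Cons.prems(4) unfolding next_hole_def
      by (cases "i = h") (auto simp: order_le_less)
  next
    case False
    show ?thesis
    proof (rule Cons.IH[of j])
      show "reads \<eta> j w" by fact
      show "reads \<zeta> j w" using k(3) j' by simp
      show "j \<le> i" using False by simp
      show "i \<le> j + int (length w)" using Cons.prems(5) j' by (auto split: if_splits)
      fix m assume "j \<le> m" "m < j + 3 * int (length w)"
      then show "\<not> hole_pair \<eta> m \<and> \<not> triple \<eta> m \<and> \<not> hole_pair \<zeta> m \<and> \<not> triple \<zeta> m"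
        using j'(1) by (intro c) (auto split: if_splits)
    qed
  qed
qed

lemma holes_forever: "(\<exists>i. \<not> evol t \<eta> i) \<longleftrightarrow> (\<exists>i. \<not> \<eta> i)"
proof (induction t)
  case (Suc t)
  have "(\<exists>i. \<not> ftasep_step (evol t \<eta>) i) \<longleftrightarrow> (\<exists>i. \<not> evol t \<eta> i)"
    by (metis hole_move_hole hole_move_surj)
  with Suc show ?case by simp
qed simp

section \<open>Laws of words\<close>

lemma ex_int_shift: "(\<exists>j. Q (j - k)) \<longleftrightarrow> (\<exists>j :: int. Q j)"
  by (metis add_diff_cancel_right')

lemma two_left_translate: "two_left (translate k \<eta>) h = two_left \<eta> (h - k)"
  by (simp add: two_left_def algebra_simps)

lemma hole_pair_translate: "hole_pair (translate k \<eta>) h = hole_pair \<eta> (h - k)"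
  by (simp add: hole_pair_def algebra_simps)

lemma triple_translate: "triple (translate k \<eta>) h = triple \<eta> (h - k)"
  by (simp add: triple_def algebra_simps)

lemma next_hole_translate: "next_hole (translate k \<eta>) i j = next_hole \<eta> (i - k) (j - k)"
proof -
  have "(\<exists>m. i < m \<and> m < j \<and> \<not> \<eta> (m - k)) \<longleftrightarrow> (\<exists>m. i - k < m \<and> m < j - k \<and> \<not> \<eta> m)"
    using ex_int_shift[of "\<lambda>m. i - k < m \<and> m < j - k \<and> \<not> \<eta> m" k] by simp
  then show ?thesis by (auto simp: next_hole_def)
qed

lemma flip_translate: "flip (translate k \<eta>) h = flip \<eta> (h - k)"
  by (simp add: flip_def hole_pair_translate triple_translate two_left_translate algebra_simps)

lemma tag_translate: "tag (translate k \<eta>) i g = tag \<eta> (i - k) (g - k)"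
proof -
  have "tag (translate k \<eta>) i g \<longleftrightarrow> (\<exists>j. next_hole \<eta> (i - k) (j - k) \<and> g - k = hole_move \<eta> (j - k))"
    unfolding tag_def next_hole_translate hole_move_def two_left_translate by auto
  then show ?thesis unfolding tag_def using ex_int_shift[of "\<lambda>j. next_hole \<eta> (i - k) j \<and> g - k = hole_move \<eta> j" k] by simp
qed

lemma reads_translate: "reads (translate k \<eta>) h w = reads \<eta> (h - k) w"
proof (induction w arbitrary: h)
  case (Cons b w)
  show ?case
    using ex_int_shift[of "\<lambda>j. next_hole \<eta> (h - k) j \<and> two_left \<eta> j = b \<and> reads \<eta> j w" k]
    by (simp only: reads.simps Cons.IH next_hole_translate two_left_translate)
qed simp

lemma flips_translate: "flips (translate k \<eta>) h n = flips \<eta> (h - k) n"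
proof (induction n arbitrary: h)
  case (Suc n)
  show ?case
    using ex_int_shift[of "\<lambda>j. next_hole \<eta> (h - k) j \<and> (flip \<eta> j \<or> flips \<eta> j n)" k]
    by (simp only: flips.simps Suc.IH next_hole_translate flip_translate)
qed simp

lemma pred_compose:
  "f \<in> borel \<rightarrow>\<^sub>M borel \<Longrightarrow> Measurable.pred borel P \<Longrightarrow> Measurable.pred borel (\<lambda>x. P (f x))"
  by (rule measurable_compose)

lemma measurable_two_left [measurable]: "Measurable.pred borel (\<lambda>\<eta>. two_left \<eta> h)"
  unfolding two_left_def by measurable

lemma measurable_hole_pair [measurable]: "Measurable.pred borel (\<lambda>\<eta>. hole_pair \<eta> h)"
  unfolding hole_pair_def by measurable

lemma measurable_triple [measurable]: "Measurable.pred borel (\<lambda>\<eta>. triple \<eta> h)"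
  unfolding triple_def by measurable

lemma measurable_flip [measurable]: "Measurable.pred borel (\<lambda>\<eta>. flip \<eta> h)"
  unfolding flip_def by measurable

lemma measurable_next_hole [measurable]: "Measurable.pred borel (\<lambda>\<eta>. next_hole \<eta> i j)"
  unfolding next_hole_def by measurable

lemma measurable_tag [measurable]: "Measurable.pred borel (\<lambda>\<eta>. tag \<eta> i g)"
proof -
  have "tag \<eta> i g \<longleftrightarrow> (\<exists>j. next_hole \<eta> i j \<and> (two_left \<eta> j \<and> g = j - 1 \<or> \<not> two_left \<eta> j \<and> g = j))" for \<eta>
    unfolding tag_def hole_move_def by auto
  then show ?thesis by simp
qed

lemma measurable_reads [measurable]: "Measurable.pred borel (\<lambda>\<eta>. reads \<eta> h w)"
  by (induction w arbitrary: h) simp_all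

lemma measurable_flips [measurable]: "Measurable.pred borel (\<lambda>\<eta>. flips \<eta> h n)"
  by (induction n arbitrary: h) simp_all

lemma measurable_unclean [measurable]: "Measurable.pred borel (\<lambda>\<eta>. unclean \<eta> n)"
  unfolding unclean_def by measurable

text \<open>The comparison sequence turns a bound on increments into monotonicity of \<^term>\<open>\<lambda>t. a t + b t\<close>.\<close>
lemma convergent_of_increment_bound:
  fixes a b :: "nat \<Rightarrow> real"
  assumes "\<And>t. \<bar>a (Suc t) - a t\<bar> \<le> b t - b (Suc t)" "\<And>t. 0 \<le> a t" "\<And>t. 0 \<le> b t"
  shows "convergent a"
proof -
  have dec: "b (Suc t) \<le> b t" "a (Suc t) + b (Suc t) \<le> a t + b t" for t
    using assms(1)[of t] by linarith+
  have "decseq b" by (rule decseq_SucI) (rule dec)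
  then have "convergent b"
    using assms(3) by (intro Bseq_monoseq_convergent decseq_bounded[where B = 0]) (auto simp: monoseq_iff)
  moreover have "decseq (\<lambda>t. a t + b t)" by (rule decseq_SucI) (rule dec)
  then have "convergent (\<lambda>t. a t + b t)"
    using assms(2,3) by (intro Bseq_monoseq_convergent decseq_bounded[where B = 0]) (auto simp: monoseq_iff)
  ultimately have "convergent (\<lambda>t. (a t + b t) - b t)" by (rule convergent_diff[rotated])
  then show ?thesis by simp
qed

section \<open>Change of the word law in one step\<close>

context inv_measure
begin

lemma pred_sets: "Measurable.pred borel P \<Longrightarrow> {\<eta>. P \<eta>} \<in> sets \<nu>"
  by (simp add: pred_def sets_eq)

lemma measure_split:
  assumes "Measurable.pred borel P" "Measurable.pred borel Q" "Measurable.pred borel R"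
    and "\<And>\<eta>. P \<eta> \<longleftrightarrow> Q \<eta> \<or> R \<eta>" "\<And>\<eta>. \<not> (Q \<eta> \<and> R \<eta>)"
  shows "measure \<nu> {\<eta>. P \<eta>} = measure \<nu> {\<eta>. Q \<eta>} + measure \<nu> {\<eta>. R \<eta>}"
proof -
  have "{\<eta>. P \<eta>} = {\<eta>. Q \<eta>} \<union> {\<eta>. R \<eta>}" using assms(4) by blast
  moreover have "{\<eta>. Q \<eta>} \<inter> {\<eta>. R \<eta>} = {}" using assms(5) by blast
  ultimately show ?thesis
    using finite_measure_Union[OF pred_sets[OF assms(2)] pred_sets[OF assms(3)]] by (simp only:)
qed

lemma measure_diff_le:
  assumes [measurable]: "Measurable.pred borel P" "Measurable.pred borel Q" "Measurable.pred borel R"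
    and "AE \<eta> in \<nu>. \<not> R \<eta> \<longrightarrow> (P \<eta> \<longleftrightarrow> Q \<eta>)"
  shows "\<bar>measure \<nu> {\<eta>. P \<eta>} - measure \<nu> {\<eta>. Q \<eta>}\<bar> \<le> measure \<nu> {\<eta>. R \<eta>}"
proof -
  have *: "measure \<nu> {\<eta>. P \<eta>} \<le> measure \<nu> {\<eta>. Q \<eta>} + measure \<nu> {\<eta>. R \<eta>}"
    if [measurable]: "Measurable.pred borel P" "Measurable.pred borel Q"
      and "AE \<eta> in \<nu>. \<not> R \<eta> \<longrightarrow> (P \<eta> \<longleftrightarrow> Q \<eta>)" for P Q
  proof -
    have "measure \<nu> {\<eta>. P \<eta>} \<le> measure \<nu> ({\<eta>. Q \<eta>} \<union> {\<eta>. R \<eta>})"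
    proof (rule finite_measure_mono_AE)
      show "AE \<eta> in \<nu>. \<eta> \<in> {\<eta>. P \<eta>} \<longrightarrow> \<eta> \<in> {\<eta>. Q \<eta>} \<union> {\<eta>. R \<eta>}"
        using that(3) by (rule eventually_mono) blast
    qed (intro sets.Un pred_sets assms that)
    also have "\<dots> \<le> measure \<nu> {\<eta>. Q \<eta>} + measure \<nu> {\<eta>. R \<eta>}"
      by (intro measure_Un_le pred_sets assms that)
    finally show ?thesis .
  qed
  have "AE \<eta> in \<nu>. \<not> R \<eta> \<longrightarrow> (Q \<eta> \<longleftrightarrow> P \<eta>)" using assms(4) by (rule eventually_mono) blast
  then show ?thesis using *[OF assms(1,2,4)] *[OF assms(2,1)] by (simp add: abs_le_iff)
qed

text \<open>A Lyapunov function: by \<open>measure_flip\<close> a step lowers it by exactly the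
  density of flips, so over all times these densities add up to at most its initial value.\<close>

definition defect :: real where
  "defect = measure \<nu> {\<eta>. hole_pair \<eta> 0} + measure \<nu> {\<eta>. triple \<eta> 0}"

text \<open>Every hole pair or triple destroyed by a step causes exactly one flip.\<close>
lemma measure_flip:
  "measure \<nu> {\<eta>. flip \<eta> 0} = defect
    - (measure \<nu> {\<eta>. hole_pair (ftasep_step \<eta>) 0} + measure \<nu> {\<eta>. triple (ftasep_step \<eta>) 0})"
proof -
  have "measure \<nu> {\<eta>. hole_pair \<eta> 0}
      = measure \<nu> {\<eta>. hole_pair \<eta> 0 \<and> \<not> two_left \<eta> 0} + measure \<nu> {\<eta>. hole_pair \<eta> 0 \<and> two_left \<eta> 0}"
    by (rule measure_split) auto
  moreover have "measure \<nu> {\<eta>. triple \<eta> 1} = measure \<nu> {\<eta>. triple \<eta> 1 \<and> (\<eta> 0 \<or> two_left \<eta> 0)}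
      + measure \<nu> {\<eta>. \<not> \<eta> 0 \<and> \<not> two_left \<eta> 0 \<and> triple \<eta> 1}"
    by (rule measure_split) auto
  moreover have "measure \<nu> {\<eta>. flip \<eta> 0} = measure \<nu> {\<eta>. hole_pair \<eta> 0 \<and> two_left \<eta> 0}
      + measure \<nu> {\<eta>. \<not> \<eta> 0 \<and> \<not> two_left \<eta> 0 \<and> triple \<eta> 1}"
    by (rule measure_split) (auto simp: flip_def)
  \<comment> \<open>Triples shift left, so the predecessor of a triple at 0 starts at 1; invariance
    moves it back.\<close>
  moreover have "measure \<nu> {\<eta>. triple \<eta> 1} = measure \<nu> {\<eta>. triple \<eta> 0}"
    using measure_translate[OF measurable_triple, of "-1" 0] by (simp add: triple_translate)
  ultimately show ?thesis by (simp add: defect_def hole_pair_step triple_step)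
qed

text \<open>A union bound over the holes that follow the origin. Sending mass from each hole to its
  successor brings the next hole to the origin, so every letter costs the same.\<close>

lemma measure_flips_le:
  "measure \<nu> {\<eta>. flips \<eta> 0 n} \<le> real n * measure \<nu> {\<eta>. flip \<eta> 0}"
proof (induction n)
  case (Suc n)
  have "measure \<nu> {\<eta>. flips \<eta> 0 (Suc n)} = measure \<nu> {\<eta>. \<exists>j. next_hole \<eta> 0 j \<and> (flip \<eta> j \<or> flips \<eta> j n)}"
    by simp
  also have "\<dots> = measure \<nu> {\<eta>. \<exists>i. next_hole \<eta> i 0 \<and> (flip \<eta> 0 \<or> flips \<eta> 0 n)}"
  proof (rule mass_transport)
    show "(next_hole (translate k \<eta>) i j \<and> (flip (translate k \<eta>) j \<or> flips (translate k \<eta>) j n)) =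
       (next_hole \<eta> (i - k) (j - k) \<and> (flip \<eta> (j - k) \<or> flips \<eta> (j - k) n))" for k \<eta> i j
      by (simp only: next_hole_translate flip_translate flips_translate)
  qed (measurable, (use next_hole_unique next_hole_inj in blast)+)
  also have "\<dots> \<le> measure \<nu> ({\<eta>. flip \<eta> 0} \<union> {\<eta>. flips \<eta> 0 n})"
    by (intro finite_measure_mono sets.Un pred_sets) auto
  also have "\<dots> \<le> measure \<nu> {\<eta>. flip \<eta> 0} + measure \<nu> {\<eta>. flips \<eta> 0 n}"
    by (intro measure_Un_le pred_sets) measurable
  finally show ?case using Suc by (simp add: algebra_simps)
qed simp

text \<open>After the step a hole at the origin bears the tag of exactly one old hole. Mass
  transport puts the sender at the origin instead; there the word before and the word delivered
  belong to one configuration and differ only through a flip among the letters read.\<close>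

lemma measure_reads_step:
  assumes "AE \<eta> in \<nu>. holes_unbounded \<eta>"
  shows "\<bar>measure \<nu> {\<eta>. reads (ftasep_step \<eta>) 0 w} - measure \<nu> {\<eta>. reads \<eta> 0 w}\<bar>
    \<le> real (length w) * measure \<nu> {\<eta>. flip \<eta> 0}"
proof -
  have [measurable]: "Measurable.pred borel (\<lambda>\<eta>. reads (ftasep_step \<eta>) g w)" for g
    by (rule pred_compose[OF measurable_ftasep_step measurable_reads])
  have "measure \<nu> {\<eta>. reads (ftasep_step \<eta>) 0 w} = measure \<nu> {\<eta>. \<exists>i. tag \<eta> i 0 \<and> reads (ftasep_step \<eta>) 0 w}"
  proof (rule measure_eq_AE)
    show "AE \<eta> in \<nu>. (\<eta> \<in> {\<eta>. reads (ftasep_step \<eta>) 0 w}) =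
        (\<eta> \<in> {\<eta>. \<exists>i. tag \<eta> i 0 \<and> reads (ftasep_step \<eta>) 0 w})"
      using assms by eventually_elim (use reads_hole tag_surj in blast)
  qed (auto intro!: pred_sets)
  also have "\<dots> = measure \<nu> {\<eta>. \<exists>g. tag \<eta> 0 g \<and> reads (ftasep_step \<eta>) g w}"
  proof (rule mass_transport[symmetric])
    show "(tag (translate k \<eta>) i j \<and> reads (ftasep_step (translate k \<eta>)) j w) =
       (tag \<eta> (i - k) (j - k) \<and> reads (ftasep_step \<eta>) (j - k) w)" for k \<eta> i j
      by (simp only: tag_translate step_translate reads_translate)
  qed (measurable, (use tag_unique tag_inj in blast)+)
  finally have *: "measure \<nu> {\<eta>. reads (ftasep_step \<eta>) 0 w} = \<dots>" .
  have "\<bar>measure \<nu> {\<eta>. \<exists>g. tag \<eta> 0 g \<and> reads (ftasep_step \<eta>) g w} - measure \<nu> {\<eta>. reads \<eta> 0 w}\<bar>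
      \<le> measure \<nu> {\<eta>. flips \<eta> 0 (length w)}"
  proof (rule measure_diff_le)
    show "AE \<eta> in \<nu>. \<not> flips \<eta> 0 (length w) \<longrightarrow>
        (\<exists>g. tag \<eta> 0 g \<and> reads (ftasep_step \<eta>) g w) = reads \<eta> 0 w"
      using assms
    proof eventually_elim
      case (elim \<eta>)
      show ?case
      proof (intro impI)
        assume nf: "\<not> flips \<eta> 0 (length w)"
        have "reads (ftasep_step \<eta>) g w = reads \<eta> 0 w" if "tag \<eta> 0 g" for g
          by (rule reads_step[OF elim that nf])
        moreover have "\<exists>g. tag \<eta> 0 g" if "reads \<eta> 0 w"
          using next_hole_exists[OF elim reads_hole[OF that]] unfolding tag_def by blast
        ultimately show "(\<exists>g. tag \<eta> 0 g \<and> reads (ftasep_step \<eta>) g w) = reads \<eta> 0 w" by blast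
      qed
    qed
  qed measurable
  also have "\<dots> \<le> real (length w) * measure \<nu> {\<eta>. flip \<eta> 0}" by (rule measure_flips_le)
  finally show ?thesis unfolding * .
qed

lemma AE_holes_unbounded:
  assumes "AE \<eta> in \<nu>. \<exists>i. \<not> \<eta> i"
  shows "AE \<eta> in \<nu>. holes_unbounded \<eta>"
proof -
  have "AE \<eta> in \<nu>. (\<exists>i. \<not> \<eta> i) \<longrightarrow> (\<forall>k. \<exists>i. 1 * i < 1 * k \<and> \<not> \<eta> i)"
    "AE \<eta> in \<nu>. (\<exists>i. \<not> \<eta> i) \<longrightarrow> (\<forall>k. \<exists>i. -1 * i < -1 * k \<and> \<not> \<eta> i)"
    by (rule AE_unbounded; simp)+
  with assms show ?thesis
    by eventually_elim (auto simp: holes_unbounded_def)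
qed

definition law :: "nat \<Rightarrow> config measure" where
  "law t = distr \<nu> borel (evol t)"

lemma measure_law:
  "Measurable.pred borel P \<Longrightarrow> measure (law t) {\<eta>. P \<eta>} = measure \<nu> {\<eta>. P (evol t \<eta>)}"
  unfolding law_def by (subst measure_distr) (auto simp: pred_def vimage_def)

text \<open>Makes the estimates for a single step available at every time.\<close>

lemma inv_law: "inv_measure (law t)"
proof -
  have "emeasure (law t) (space (law t)) \<noteq> \<infinity>"
    unfolding law_def by (subst emeasure_distr) (auto simp: emeasure_eq_measure)
  then interpret L: finite_measure "law t" by (rule finite_measureI)
  have sets: "sets (law t) = sets borel" by (simp add: law_def)
  have "translate k \<circ> evol t = evol t \<circ> translate k" for k
    by (simp add: fun_eq_iff evol_translate)
  then have "distr (law t) borel (translate k) = distr (distr \<nu> borel (translate k)) borel (evol t)" for k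
    unfolding law_def by (subst (1 2) distr_distr) auto
  then have "distr (law t) borel (translate k) = law t" for k
    by (simp add: distr_translate law_def)
  with sets show ?thesis by unfold_locales
qed

end

section \<open>Convergence\<close>

lemma convergent_sandwich:
  fixes x y z :: "nat \<Rightarrow> real"
  assumes "\<And>t. \<bar>x t - y t\<bar> \<le> z t" "convergent y" "z \<longlonglongrightarrow> 0"
  shows "convergent x"
proof -
  have "(\<lambda>t. x t - y t) \<longlonglongrightarrow> 0"
    by (rule Lim_null_comparison[OF _ assms(3)]) (simp add: assms(1))
  then have "convergent (\<lambda>t. y t + (x t - y t))"
    using assms(2) by (intro convergent_add) (auto simp: convergent_def)
  then show ?thesis by simp
qed

section \<open>Rarity of defects, partition by words, restriction to invariant events\<close>

context inv_measure
begin

lemma defect_nonneg: "0 \<le> defect"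
  by (simp add: defect_def)

lemma measure_triple_le: "measure \<nu> {\<eta>. triple \<eta> j} \<le> defect"
  using measure_translate[OF measurable_triple, of "- j" 0] by (simp add: triple_translate defect_def)

lemma measure_hole_pair_triple_le: "measure \<nu> {\<eta>. hole_pair \<eta> j \<or> triple \<eta> j} \<le> defect"
proof -
  have "measure \<nu> {\<eta>. hole_pair \<eta> j \<or> triple \<eta> j} = measure \<nu> ({\<eta>. hole_pair \<eta> j} \<union> {\<eta>. triple \<eta> j})"
    by (rule arg_cong[where f = "measure \<nu>"]) auto
  also have "\<dots> \<le> measure \<nu> {\<eta>. hole_pair \<eta> j} + measure \<nu> {\<eta>. triple \<eta> j}"
    by (intro measure_Un_le pred_sets) auto
  finally show ?thesis
    using measure_translate[OF measurable_triple, of "- j" 0] measure_translate[OF measurable_hole_pair, of "- j" 0]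
    by (simp add: triple_translate hole_pair_translate defect_def)
qed

lemma measure_unclean_le: "measure \<nu> {\<eta>. unclean \<eta> n} \<le> real n * defect"
proof (induction n)
  case 0
  then show ?case by (simp add: unclean_def)
next
  case (Suc n)
  have "measure \<nu> {\<eta>. unclean \<eta> (Suc n)}
      = measure \<nu> ({\<eta>. unclean \<eta> n} \<union> {\<eta>. hole_pair \<eta> (int n) \<or> triple \<eta> (int n)})"
    by (rule arg_cong[where f = "measure \<nu>"]) (auto simp: unclean_def less_Suc_eq)
  also have "\<dots> \<le> measure \<nu> {\<eta>. unclean \<eta> n} + measure \<nu> {\<eta>. hole_pair \<eta> (int n) \<or> triple \<eta> (int n)}"
    by (intro measure_Un_le pred_sets) auto
  finally show ?case using Suc measure_hole_pair_triple_le[of "int n"] by (simp add: algebra_simps)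
qed

lemma measure_reads_partition:
  assumes "AE \<eta> in \<nu>. holes_unbounded \<eta>" and [measurable]: "D \<in> sets borel"
  shows "measure \<nu> {\<eta>. \<not> \<eta> 0 \<and> \<eta> \<in> D} = (\<Sum>w | length w = m. measure \<nu> {\<eta>. reads \<eta> 0 w \<and> \<eta> \<in> D})"
proof -
  have fin: "finite {w :: bool list. length w = m}"
    using finite_lists_length_eq[of "UNIV :: bool set" m] by simp
  have "measure \<nu> {\<eta>. \<not> \<eta> 0 \<and> \<eta> \<in> D} = measure \<nu> (\<Union>w\<in>{w. length w = m}. {\<eta>. reads \<eta> 0 w \<and> \<eta> \<in> D})"
  proof (rule measure_eq_AE)
    show "AE \<eta> in \<nu>. (\<eta> \<in> {\<eta>. \<not> \<eta> 0 \<and> \<eta> \<in> D}) = (\<eta> \<in> (\<Union>w\<in>{w. length w = m}. {\<eta>. reads \<eta> 0 w \<and> \<eta> \<in> D}))"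
      using assms(1)
    proof eventually_elim
      case (elim \<eta>)
      show ?case
        using reads_exists[OF elim, of 0 m] reads_hole[of \<eta> 0] by auto
    qed
    show "(\<Union>w\<in>{w. length w = m}. {\<eta>. reads \<eta> 0 w \<and> \<eta> \<in> D}) \<in> sets \<nu>"
      by (intro sets.finite_UN fin pred_sets) measurable
  qed (intro pred_sets, measurable)
  also have "\<dots> = (\<Sum>w | length w = m. measure \<nu> {\<eta>. reads \<eta> 0 w \<and> \<eta> \<in> D})"
  proof (rule finite_measure_finite_Union[OF fin])
    show "(\<lambda>w. {\<eta>. reads \<eta> 0 w \<and> \<eta> \<in> D}) ` {w. length w = m} \<subseteq> sets \<nu>"
      by (auto intro!: pred_sets)
    show "disjoint_family_on (\<lambda>w. {\<eta>. reads \<eta> 0 w \<and> \<eta> \<in> D}) {w. length w = m}"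
      using reads_unique by (fastforce simp: disjoint_family_on_def)
  qed
  finally show ?thesis .
qed

lemma measure_law_Suc:
  assumes "Measurable.pred borel P"
  shows "measure (law (Suc t)) {\<eta>. P \<eta>} = measure (law t) {\<eta>. P (ftasep_step \<eta>)}"
  using measure_law[OF assms] measure_law[OF pred_compose[OF measurable_ftasep_step assms]] by simp

text \<open>This density is the restriction of \<open>\<nu>\<close> to \<open>A\<close>. It lets
  each case be treated as a measure for which the defining property holds almost everywhere.\<close>

lemma inv_density:
  assumes [measurable]: "A \<in> sets borel" and A: "\<And>k \<eta>. translate k \<eta> \<in> A \<longleftrightarrow> \<eta> \<in> A"
  shows "inv_measure (density \<nu> (indicator A))"
proof -
  let ?\<rho> = "density \<nu> (indicator A)"
  have em: "emeasure ?\<rho> X = emeasure \<nu> (A \<inter> X)" if "X \<in> sets borel" for X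
    using that by (intro emeasure_restricted) (auto simp: sets_eq)
  then have "emeasure ?\<rho> (space ?\<rho>) \<noteq> \<infinity>" by (simp add: emeasure_eq_measure)
  then interpret R: finite_measure ?\<rho> by (rule finite_measureI)
  have "distr ?\<rho> borel (translate k) = ?\<rho>" for k
  proof (rule measure_eqI)
    fix X assume "X \<in> sets (distr ?\<rho> borel (translate k))"
    then have X [measurable]: "X \<in> sets borel" by simp
    have "emeasure (distr ?\<rho> borel (translate k)) X = emeasure ?\<rho> {\<eta>. translate k \<eta> \<in> X}"
      by (subst emeasure_distr) (auto simp: vimage_def)
    also have "\<dots> = emeasure \<nu> {\<eta>. translate k \<eta> \<in> A \<inter> X}"
      by (subst em) (auto simp: A intro!: arg_cong[where f = "emeasure \<nu>"])
    also have "\<dots> = emeasure \<nu> {\<eta>. \<eta> \<in> A \<inter> X}"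
      using measure_translate[of "\<lambda>\<eta>. \<eta> \<in> A \<inter> X" k] by (simp add: emeasure_eq_measure)
    also have "\<dots> = emeasure ?\<rho> X" by (subst em) (auto simp: Int_def)
    finally show "emeasure (distr ?\<rho> borel (translate k)) X = emeasure ?\<rho> X" .
  qed (simp add: sets_eq)
  then show ?thesis by unfold_locales (simp_all add: sets_eq)
qed

end

text \<open>What remains once permanent holes and permanently occupied moving sites are excluded.
  \<open>visited\<close> ends every hole pair and \<open>moving_hole\<close> every triple;
  \<open>moving_hole\<close> also supplies the holes at which words start.\<close>

locale transient_defects = inv_measure +
  assumes visited: "AE \<eta> in \<nu>. \<forall>j. \<exists>t. evol t \<eta> j"
    and moving_hole: "AE \<eta> in \<nu>. \<forall>j. \<exists>t. \<not> evol t \<eta> (j - int t)"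
begin

text \<open>Having a hole at one time is equivalent to having one at any other time, and by
  stationarity one hole entails holes arbitrarily far out on both sides.\<close>

lemma law_unbounded: "AE \<eta> in law t. holes_unbounded \<eta>"
proof -
  have "AE \<eta> in \<nu>. \<exists>i. \<not> evol t \<eta> i"
    using moving_hole by eventually_elim (metis holes_forever)
  then have "AE \<eta> in law t. \<exists>i. \<not> \<eta> i"
    unfolding law_def by (subst AE_distr_iff) auto
  then show ?thesis by (rule inv_measure.AE_holes_unbounded[OF inv_law])
qed

text \<open>Hole pairs never appear anew at a given site, and triples never appear anew at a given site of
  the frame moving left at unit speed.\<close>
lemma defect_tendsto_0: "(\<lambda>t. inv_measure.defect (law t)) \<longlonglongrightarrow> 0"
proof -
  have [measurable]: "Measurable.pred borel (\<lambda>\<eta>. hole_pair (evol t \<eta>) j)"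
    "Measurable.pred borel (\<lambda>\<eta>. triple (evol t \<eta>) j)" for t j
    by (rule pred_compose[OF measurable_ftasep_steps]; measurable)+
  have pairs: "(\<lambda>t. measure (law t) {\<eta>. hole_pair \<eta> 0}) \<longlonglongrightarrow> measure \<nu> {}"
    unfolding measure_law[OF measurable_hole_pair]
  proof (rule tendsto_measure)
    show "AE \<eta> in \<nu>. eventually (\<lambda>t. \<eta> \<in> {\<eta>. hole_pair (evol t \<eta>) 0} \<longleftrightarrow> \<eta> \<in> {}) sequentially"
      using visited
    proof eventually_elim
      case (elim \<eta>)
      then obtain T where "evol T \<eta> 0" by blast
      then have "\<not> hole_pair (evol T \<eta>) 0" by (simp add: hole_pair_def)
      have "\<not> hole_pair (evol t \<eta>) 0" if "t \<ge> T" for t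
        using that by (induction t rule: dec_induct) (use \<open>\<not> hole_pair (evol T \<eta>) 0\<close> in \<open>auto simp: hole_pair_step\<close>)
      then show ?case by (auto simp: eventually_sequentially)
    qed
  qed measurable
  have "(\<lambda>t. measure \<nu> {\<eta>. triple (evol t \<eta>) (- int t)}) \<longlonglongrightarrow> measure \<nu> {}"
  proof (rule tendsto_measure)
    show "AE \<eta> in \<nu>. eventually (\<lambda>t. \<eta> \<in> {\<eta>. triple (evol t \<eta>) (- int t)} \<longleftrightarrow> \<eta> \<in> {}) sequentially"
      using moving_hole
    proof eventually_elim
      case (elim \<eta>)
      then obtain T where T: "\<not> evol T \<eta> (0 - int T)" by blast
      have "\<not> triple (evol t \<eta>) (- int t)" if "t \<ge> T" for t
        using that
      proof (induction t rule: dec_induct)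
        case base
        then show ?case using T by (simp add: triple_def)
      next
        case (step t)
        then show ?case using triple_step[of "evol t \<eta>" "- int (Suc t)"] by simp
      qed
      then show ?case by (auto simp: eventually_sequentially)
    qed
  qed measurable
  \<comment> \<open>Invariance brings the moving site \<open>- int t\<close> back to the
    origin.\<close>
  moreover have "measure \<nu> {\<eta>. triple (evol t \<eta>) (- int t)} = measure (law t) {\<eta>. triple \<eta> 0}" for t
    using measure_translate[of "\<lambda>\<eta>. triple (evol t \<eta>) 0" "int t"]
    by (simp add: evol_translate triple_translate measure_law)
  ultimately have "(\<lambda>t. measure (law t) {\<eta>. triple \<eta> 0}) \<longlonglongrightarrow> 0" by simp
  then show ?thesis
    unfolding inv_measure.defect_def[OF inv_law] using tendsto_add[OF pairs] by fastforce
qed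

lemma convergent_reads: "convergent (\<lambda>t. measure (law t) {\<eta>. reads \<eta> 0 w})"
proof (rule convergent_of_increment_bound)
  fix t
  interpret L: inv_measure "law t" by (rule inv_law)
  \<comment> \<open>The flip density is the drop of \<open>defect\<close> in this step, which makes
    the increment bounds telescope.\<close>
  have "L.defect - inv_measure.defect (law (Suc t)) = measure (law t) {\<eta>. flip \<eta> 0}"
    unfolding L.measure_flip inv_measure.defect_def[OF inv_law] by (simp add: measure_law_Suc)
  then show "\<bar>measure (law (Suc t)) {\<eta>. reads \<eta> 0 w} - measure (law t) {\<eta>. reads \<eta> 0 w}\<bar>
      \<le> real (length w) * L.defect - real (length w) * inv_measure.defect (law (Suc t))"
    using L.measure_reads_step[OF law_unbounded, of w]
    by (simp add: measure_law_Suc right_diff_distrib[symmetric])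
  show "0 \<le> real (length w) * L.defect" using L.defect_nonneg by simp
qed simp

lemma unclean_tendsto_0: "(\<lambda>t. measure (law t) {\<eta>. unclean \<eta> n}) \<longlonglongrightarrow> 0"
proof (rule tendsto_sandwich[OF _ _ tendsto_const])
  show "(\<lambda>t. real n * inv_measure.defect (law t)) \<longlonglongrightarrow> 0"
    using tendsto_mult_left[OF defect_tendsto_0, of "real n"] by simp
qed (auto simp: inv_measure.measure_unclean_le[OF inv_law])

text \<open>The event is cut up according to the word of length \<open>m\<close> read at 0. Outside
  the unclean event, whose probability vanishes, each word either implies \<open>D\<close> or
  excludes it, and the law of each word converges.\<close>

lemma convergent_hole_at_0:
  assumes D: "depends_on {0..int m} D" and [measurable]: "D \<in> sets borel"
  shows "convergent (\<lambda>t. measure (law t) {\<eta>. \<not> \<eta> 0 \<and> \<eta> \<in> D})"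
proof -
  have "convergent (\<lambda>t. measure (law t) {\<eta>. reads \<eta> 0 w \<and> \<eta> \<in> D})" if w: "length w = m" for w
  proof -
    \<comment> \<open>A truth value that depends on \<open>w\<close> only: all clean configurations
      reading \<open>w\<close> agree on \<open>{0..int m}\<close>, so one of them decides for
      all.\<close>
    define c where "c \<longleftrightarrow> (\<exists>\<zeta>. reads \<zeta> 0 w \<and> \<zeta> \<in> D \<and> \<not> unclean \<zeta> (3 * m))"
    have c: "\<not> unclean \<eta> (3 * m) \<longrightarrow> (reads \<eta> 0 w \<and> \<eta> \<in> D \<longleftrightarrow> reads \<eta> 0 w \<and> c)" for \<eta>
    proof (intro impI)
      assume u: "\<not> unclean \<eta> (3 * m)"
      have "\<eta> \<in> D" if r: "reads \<eta> 0 w" and "c"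
      proof -
        obtain \<zeta> where \<zeta>: "reads \<zeta> 0 w" "\<zeta> \<in> D" "\<not> unclean \<zeta> (3 * m)" using \<open>c\<close> by (auto simp: c_def)
        have "\<eta> i = \<zeta> i" if "0 \<le> i" "i \<le> int m" for i
        proof (rule reads_determines[OF r \<zeta>(1)])
          fix m' :: int assume m': "0 \<le> m'" "m' < 0 + 3 * int (length w)"
          then have "m' = int (nat m')" "nat m' < 3 * m" using w by auto
          then show "\<not> hole_pair \<eta> m' \<and> \<not> triple \<eta> m' \<and> \<not> hole_pair \<zeta> m' \<and> \<not> triple \<zeta> m'"
            using u \<zeta>(3) unfolding unclean_def by metis
        qed (use that w in auto)
        then show ?thesis using D \<zeta>(2) unfolding depends_on_def by (metis atLeastAtMost_iff)
      qed
      then show "reads \<eta> 0 w \<and> \<eta> \<in> D \<longleftrightarrow> reads \<eta> 0 w \<and> c" using u by (auto simp: c_def)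
    qed
    show ?thesis
    proof (rule convergent_sandwich[OF _ _ unclean_tendsto_0[of "3 * m"]])
      show "\<bar>measure (law t) {\<eta>. reads \<eta> 0 w \<and> \<eta> \<in> D} - measure (law t) {\<eta>. reads \<eta> 0 w \<and> c}\<bar>
          \<le> measure (law t) {\<eta>. unclean \<eta> (3 * m)}" for t
      proof -
        interpret L: inv_measure "law t" by (rule inv_law)
        show ?thesis by (rule L.measure_diff_le) (measurable, use c in auto)
      qed
      show "convergent (\<lambda>t. measure (law t) {\<eta>. reads \<eta> 0 w \<and> c})"
        using convergent_reads[of w] by (cases c) (auto simp: convergent_const)
    qed
  qed
  then have "convergent (\<lambda>t. \<Sum>w | length w = m. measure (law t) {\<eta>. reads \<eta> 0 w \<and> \<eta> \<in> D})"
    by (intro convergent_sum) auto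
  then show ?thesis
    using inv_measure.measure_reads_partition[OF inv_law law_unbounded, of D _ m] by simp
qed

lemma convergent_hole_at:
  assumes D: "depends_on {a..a + int m} D" and [measurable]: "D \<in> sets borel"
  shows "convergent (\<lambda>t. measure (law t) {\<eta>. \<not> \<eta> a \<and> \<eta> \<in> D})"
proof -
  have "measure (law t) {\<eta>. \<not> \<eta> 0 \<and> translate a \<eta> \<in> D} = measure (law t) {\<eta>. \<not> \<eta> a \<and> \<eta> \<in> D}" for t
    using inv_measure.measure_translate[OF inv_law, of "\<lambda>\<eta>. \<not> \<eta> a \<and> \<eta> \<in> D" t a] by simp
  moreover have "convergent (\<lambda>t. measure (law t) {\<eta>. \<not> \<eta> 0 \<and> \<eta> \<in> {\<eta>. translate a \<eta> \<in> D}})"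
  proof (rule convergent_hole_at_0)
    show "depends_on {0..int m} {\<eta>. translate a \<eta> \<in> D}"
      unfolding depends_on_def
    proof (intro allI impI)
      fix \<eta> \<zeta> :: config assume "\<forall>i\<in>{0..int m}. \<eta> i = \<zeta> i"
      then have "\<forall>i\<in>{a..a + int m}. translate a \<eta> i = translate a \<zeta> i" by auto
      then show "(\<eta> \<in> {\<eta>. translate a \<eta> \<in> D}) = (\<zeta> \<in> {\<eta>. translate a \<eta> \<in> D})"
        using D unfolding depends_on_def by blast
    qed
  qed measurable
  ultimately show ?thesis by simp
qed

text \<open>A word can start only at a hole, so \<open>C\<close> is split by the last hole at or
  before the left end \<open>?a\<close> of its window. Three sites suffice: if \<open>?a\<close>,
  \<open>?a - 1\<close> and \<open>?a - 2\<close> are all occupied they form a triple, whose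
  probability is at most \<open>defect\<close> and tends to 0.\<close>

lemma convergent_local:
  assumes "C \<in> local_sets"
  shows "convergent (\<lambda>t. measure (law t) C)"
proof -
  have [measurable]: "C \<in> sets borel" using assms by (rule local_borel)
  obtain S where S: "finite S" "depends_on S C" using assms by (auto simp: local_sets_def)
  obtain b where b: "abs ` S \<subseteq> {..b}" using S(1) finite_int_iff_bounded_le by blast
  define m where "m = nat (max b 0)"
  have "S \<subseteq> {- int m..int m}" using b by (force simp: m_def)
  then have C: "depends_on {- int m..int m} C" using S(2) depends_on_mono by blast
  let ?a = "- int m"
  let ?T0 = "\<lambda>\<eta>. \<not> \<eta> ?a \<and> \<eta> \<in> C"
  let ?T1 = "\<lambda>\<eta>. \<not> \<eta> (?a - 1) \<and> \<eta> \<in> {\<eta>. \<eta> ?a \<and> \<eta> \<in> C}"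
  let ?T2 = "\<lambda>\<eta>. \<not> \<eta> (?a - 2) \<and> \<eta> \<in> {\<eta>. \<eta> (?a - 1) \<and> \<eta> ?a \<and> \<eta> \<in> C}"
  let ?T3 = "\<lambda>\<eta>. triple \<eta> (?a - 2) \<and> \<eta> \<in> C"
  let ?p = "\<lambda>T t. measure (law t) {\<eta>. T \<eta>}"
  have dep: "\<eta> \<in> C \<longleftrightarrow> \<zeta> \<in> C" if "\<forall>i\<in>{- int m..int m}. \<eta> i = \<zeta> i" for \<eta> \<zeta>
    using C that unfolding depends_on_def by blast
  have split: "measure (law t) C = ?p ?T0 t + ?p ?T1 t + ?p ?T2 t + ?p ?T3 t" for t
  proof -
    interpret L: inv_measure "law t" by (rule inv_law)
    have [simp]: "?a - 2 + 1 = ?a - 1" "?a - 2 + 2 = ?a" by simp_all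
    have "?p (\<lambda>\<eta>. \<eta> \<in> C) t = ?p ?T0 t + ?p (\<lambda>\<eta>. \<eta> ?a \<and> \<eta> \<in> C) t"
      by (rule L.measure_split) auto
    moreover have "?p (\<lambda>\<eta>. \<eta> ?a \<and> \<eta> \<in> C) t = ?p ?T1 t + ?p (\<lambda>\<eta>. \<eta> (?a - 1) \<and> \<eta> ?a \<and> \<eta> \<in> C) t"
      by (rule L.measure_split) auto
    moreover have "?p (\<lambda>\<eta>. \<eta> (?a - 1) \<and> \<eta> ?a \<and> \<eta> \<in> C) t = ?p ?T2 t + ?p ?T3 t"
      by (rule L.measure_split) (auto simp: triple_def)
    ultimately show ?thesis by simp
  qed
  \<comment> \<open>The window ends \<open>2 * m\<close> sites after \<open>?a\<close>; starting one
    or two sites earlier lengthens it accordingly.\<close>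
  have "convergent (?p ?T0)"
    by (rule convergent_hole_at[where m = "2 * m"]) (use C in auto)
  moreover have "convergent (?p ?T1)"
  proof (rule convergent_hole_at[where m = "2 * m + 1"])
    show "depends_on {?a - 1..?a - 1 + int (2 * m + 1)} {\<eta>. \<eta> ?a \<and> \<eta> \<in> C}"
      unfolding depends_on_def
    proof (intro allI impI)
      fix \<eta> \<zeta> :: config assume *: "\<forall>i\<in>{?a - 1..?a - 1 + int (2 * m + 1)}. \<eta> i = \<zeta> i"
      then have "\<eta> ?a = \<zeta> ?a" "\<eta> \<in> C \<longleftrightarrow> \<zeta> \<in> C" by (auto intro!: dep)
      then show "(\<eta> \<in> {\<eta>. \<eta> ?a \<and> \<eta> \<in> C}) = (\<zeta> \<in> {\<eta>. \<eta> ?a \<and> \<eta> \<in> C})" by simp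
    qed
  qed measurable
  moreover have "convergent (?p ?T2)"
  proof (rule convergent_hole_at[where m = "2 * m + 2"])
    show "depends_on {?a - 2..?a - 2 + int (2 * m + 2)} {\<eta>. \<eta> (?a - 1) \<and> \<eta> ?a \<and> \<eta> \<in> C}"
      unfolding depends_on_def
    proof (intro allI impI)
      fix \<eta> \<zeta> :: config assume *: "\<forall>i\<in>{?a - 2..?a - 2 + int (2 * m + 2)}. \<eta> i = \<zeta> i"
      then have "\<eta> ?a = \<zeta> ?a" "\<eta> (?a - 1) = \<zeta> (?a - 1)" "\<eta> \<in> C \<longleftrightarrow> \<zeta> \<in> C" by (auto intro!: dep)
      then show "(\<eta> \<in> {\<eta>. \<eta> (?a - 1) \<and> \<eta> ?a \<and> \<eta> \<in> C}) = (\<zeta> \<in> {\<eta>. \<eta> (?a - 1) \<and> \<eta> ?a \<and> \<eta> \<in> C})" by simp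
    qed
  qed measurable
  ultimately have conv: "convergent (\<lambda>t. ?p ?T0 t + ?p ?T1 t + ?p ?T2 t)"
    by (intro convergent_add)
  show ?thesis
  proof (rule convergent_sandwich[OF _ conv defect_tendsto_0])
    fix t
    interpret L: inv_measure "law t" by (rule inv_law)
    have "?p ?T3 t \<le> measure (law t) {\<eta>. triple \<eta> (?a - 2)}"
      by (intro L.finite_measure_mono L.pred_sets) auto
    also have "\<dots> \<le> L.defect" by (rule L.measure_triple_le)
    finally show "\<bar>measure (law t) C - (?p ?T0 t + ?p ?T1 t + ?p ?T2 t)\<bar> \<le> L.defect"
      by (simp add: split)
  qed
qed

lemma convergent_transient:
  assumes C: "C \<in> local_sets"
  shows "convergent (\<lambda>t. measure \<nu> {\<eta>. evol t \<eta> \<in> C})"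
proof -
  have "Measurable.pred borel (\<lambda>\<eta>. \<eta> \<in> C)" using local_borel[OF C] by measurable
  from measure_law[OF this] convergent_local[OF C] show ?thesis by simp
qed

end

text \<open>All three events \<open>H\<close>, \<open>P\<close> and \<open>N\<close> are invariant,
  so \<open>\<nu>\<close> is the sum of three invariant measures, each of which satisfies one of the
  convergence results.\<close>

lemma (in inv_measure) convergent_law:
  assumes C: "C \<in> local_sets"
  shows "convergent (\<lambda>t. measure \<nu> {\<eta>. evol t \<eta> \<in> C})"
proof -
  have [measurable]: "C \<in> sets borel" using C by (rule local_borel)
  define H where "H = {\<eta>. \<exists>j. \<forall>t. \<not> evol t \<eta> j}"
  \<comment> \<open>Removing \<open>H\<close> makes the cases disjoint, so that their contributions
    add up.\<close>
  define P where "P = {\<eta>. \<exists>j. \<forall>t. evol t \<eta> (j - int t)} - H"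
  define N where "N = - (H \<union> P)"
  have H [measurable]: "H \<in> sets borel" unfolding H_def by measurable
  have P [measurable]: "P \<in> sets borel" unfolding P_def by measurable
  have N [measurable]: "N \<in> sets borel" unfolding N_def by measurable
  have invH: "translate k \<eta> \<in> H \<longleftrightarrow> \<eta> \<in> H" for k \<eta>
    using ex_int_shift[of "\<lambda>j. \<forall>t. \<not> evol t \<eta> j" k] by (simp add: H_def evol_translate)
  have invP: "translate k \<eta> \<in> P \<longleftrightarrow> \<eta> \<in> P" for k \<eta>
    using ex_int_shift[of "\<lambda>j. \<forall>t. evol t \<eta> (j - int t)" k] invH
    by (simp add: P_def evol_translate algebra_simps)
  have invN: "translate k \<eta> \<in> N \<longleftrightarrow> \<eta> \<in> N" for k \<eta>
    by (simp add: N_def invH invP)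
  have AEI: "AE \<eta> in density \<nu> (indicator A). Q \<eta>" if "A \<in> sets borel" "\<And>\<eta>. \<eta> \<in> A \<Longrightarrow> Q \<eta>" for A Q
    using that by (subst AE_density) (auto simp: indicator_def sets_eq)
  interpret H: inv_measure "density \<nu> (indicator H)" by (rule inv_density[OF H invH])
  interpret P: inv_measure "density \<nu> (indicator P)" by (rule inv_density[OF P invP])
  interpret N: inv_measure "density \<nu> (indicator N)" by (rule inv_density[OF N invN])
  have "transient_defects (density \<nu> (indicator N))"
  proof
    show "AE \<eta> in density \<nu> (indicator N). \<forall>j. \<exists>t. evol t \<eta> j"
      by (rule AEI[OF N]) (auto simp: N_def H_def)
    show "AE \<eta> in density \<nu> (indicator N). \<forall>j. \<exists>t. \<not> evol t \<eta> (j - int t)"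
      by (rule AEI[OF N]) (auto simp: N_def P_def)
  qed
  then have "convergent (\<lambda>t. measure (density \<nu> (indicator N)) {\<eta>. evol t \<eta> \<in> C})"
    by (rule transient_defects.convergent_transient[OF _ C])
  moreover have "convergent (\<lambda>t. measure (density \<nu> (indicator H)) {\<eta>. evol t \<eta> \<in> C})"
    by (rule H.convergent_if_hole[OF AEI[OF H] C]) (simp add: H_def)
  moreover have "convergent (\<lambda>t. measure (density \<nu> (indicator P)) {\<eta>. evol t \<eta> \<in> C})"
    by (rule P.convergent_if_moving_particle[OF AEI[OF P] C]) (simp add: P_def)
  moreover have "measure (density \<nu> (indicator A)) {\<eta>. evol t \<eta> \<in> C} = measure \<nu> {\<eta>. \<eta> \<in> A \<and> evol t \<eta> \<in> C}"
    if [measurable]: "A \<in> sets borel" for A t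
  proof -
    have "{\<eta>. evol t \<eta> \<in> C} \<in> sets \<nu>" by (rule pred_sets) measurable
    then show ?thesis using that by (subst measure_restricted) (auto simp: sets_eq Int_def)
  qed
  moreover have "measure \<nu> {\<eta>. evol t \<eta> \<in> C} = measure \<nu> {\<eta>. \<eta> \<in> N \<and> evol t \<eta> \<in> C}
    + (measure \<nu> {\<eta>. \<eta> \<in> H \<and> evol t \<eta> \<in> C} + measure \<nu> {\<eta>. \<eta> \<in> P \<and> evol t \<eta> \<in> C})" for t
  proof -
    have "measure \<nu> {\<eta>. evol t \<eta> \<in> C} = measure \<nu> {\<eta>. \<eta> \<in> N \<and> evol t \<eta> \<in> C} + measure \<nu> {\<eta>. \<eta> \<notin> N \<and> evol t \<eta> \<in> C}"
      by (rule measure_split) auto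
    moreover have "measure \<nu> {\<eta>. \<eta> \<notin> N \<and> evol t \<eta> \<in> C}
        = measure \<nu> {\<eta>. \<eta> \<in> H \<and> evol t \<eta> \<in> C} + measure \<nu> {\<eta>. \<eta> \<in> P \<and> evol t \<eta> \<in> C}"
      by (rule measure_split) (auto simp: N_def P_def)
    ultimately show ?thesis by simp
  qed
  ultimately show ?thesis by (simp add: convergent_add)
qed

theorem theorem2p5:
  fixes \<mu>0 :: "config measure"
  assumes "config_measure \<mu>0" and "translation_invariant \<mu>0"
  shows "\<exists>\<mu>inf. config_measure \<mu>inf \<and> converges_weakly (ftasep_evolve \<mu>0) \<mu>inf"
proof (rule weak_limit_exists)
  interpret prob_space \<mu>0 using assms(1) by (simp add: config_measure_def)
  have sets: "sets \<mu>0 = sets borel" using assms(1) by (simp add: config_measure_def)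
  interpret inv_measure \<mu>0
    using assms(2) sets by unfold_locales (auto simp: translation_invariant_def)
  have meas: "evol t \<in> \<mu>0 \<rightarrow>\<^sub>M borel" for t by measurable
  show "config_measure (ftasep_evolve \<mu>0 t)" for t
    unfolding config_measure_def ftasep_evolve_def using prob_space_distr[OF meas] by simp
  show "convergent (\<lambda>t. measure (ftasep_evolve \<mu>0 t) C)" if C: "C \<in> local_sets" for C
  proof -
    have "measure (ftasep_evolve \<mu>0 t) C = measure \<mu>0 {\<eta>. evol t \<eta> \<in> C}" for t
      unfolding ftasep_evolve_def using local_borel[OF C] by (subst measure_distr[OF meas]) (auto simp: vimage_def)
    then show ?thesis using convergent_law[OF C] by simp
  qed
qed

end
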